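(* Let $\Bbbk$ be a field, let $\Delta$ be a finite simplicial complex on $[m]=\{1,\dots,m\}$ without ghost vertices, and let $n_1,\dots,n_m\ge 2$ be integers. Put $A=A_{\Delta,\mathbf n}=\Bbbk[x_1,\dots,x_m]/\bigl(I_\Delta+(x_1^{n_1},\dots,x_m^{n_m})\bigr)$. Then $$\operatorname{tr}_{A}(\omega_{A})=\sum_{(\mathcal C,K)\ \text{admissible}}J_{\mathcal C,K},\qquad J_{\mathcal C,K}=\Bigl(x_K\prod_{j\in U_{\mathcal C}\setminus F}x_j^{n_j-1}\;:\;F\in\mathcal C\Bigr)A,$$ where the sum is over all admissible pairs $(\mathcal C,K)$.
   Context: A simplicial complex $\Delta$ on $[m]=\{1,\dots,m\}$ is a set of subsets (faces) of $[m]$ closed under taking subsets and containing $\varnothing$. A vertex $i$ is a ghost vertex if $\{i\}\notin\Delta$. $\mathcal F(\Delta)$ denotes the set of facets (maximal faces). For $F\subseteq[m]$ put $x_F=\prod_{i\in F}x_i$ (so $x_\varnothing=1$); $I_\Delta=(x_F: F\subseteq [m],\ F\notin\Delta)$ is the Stanley--Reisner ideal. For an Artinian positively graded $\Bbbk$-algebra $A$ (with $A_0=\Bbbk$), the canonical module is $\omega_A=\operatorname{Hom}_{\Bbbk}(A,\Bbbk)$ with $(a\lambda)(b)=\lambda(ab)$. The canonical trace is the ideal $\operatorname{tr}_A(\omega_A)=\sum_{\varphi\in\operatorname{Hom}_A(\omega_A,A)}\varphi(\omega_A)$. For a nonempty family $\mathcal C\subseteq\mathcal F(\Delta)$ put $U_{\mathcal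 C}=\bigcup_{F\in\mathcal C}F$ and $I_{\mathcal C}=\bigcap_{F\in\mathcal C}F$. For $K\subseteq I_{\mathcal C}$ and $F\in\mathcal C$ put $D_F(\mathcal C,K)=K\cup(U_{\mathcal C}\setminus F)$. The pair $(\mathcal C,K)$, with $\mathcal C\subseteq\mathcal F(\Delta)$ nonempty and $K\subseteq I_{\mathcal C}$, is called admissible if $D_F(\mathcal C,K)\in\Delta$ for every $F\in\mathcal C$ and $$\mathcal C=\{G\in\mathcal F(\Delta): D_F(\mathcal C,K)\subseteq G\text{ for some }F\in\mathcal C\}.$$ *)

theory Defs
  imports "HOL-Algebra.Algebra" "HOL-Library.Poly_Mapping"
begin

text \<open>
  An element of \<^typ>\<open>(nat \<Rightarrow>\<^sub>0 nat) \<Rightarrow>\<^sub>0 'k\<close> is a polynomial in indeterminates indexed by all natural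
  numbers (a finitely supported map from exponent vectors to coefficients); only those in
  \<open>1, \<dots>, m\<close> are admitted in \<open>poly_ring m\<close>.
\<close>

type_synonym 'k mpoly = "(nat \<Rightarrow>\<^sub>0 nat) \<Rightarrow>\<^sub>0 'k"

definition poly_ring :: "nat \<Rightarrow> ('k::field) mpoly ring" where
  "poly_ring m = \<lparr>carrier = {p. \<forall>t \<in> Poly_Mapping.keys p. Poly_Mapping.keys t \<subseteq> {1..m}},
     monoid.mult = (*), monoid.one = 1, ring.zero = 0, ring.add = (+)\<rparr>"

definition const :: "'k::field \<Rightarrow> 'k mpoly" where
  "const c = Poly_Mapping.single 0 c"

definition var :: "nat \<Rightarrow> ('k::field) mpoly" where
  "var i = Poly_Mapping.single (Poly_Mapping.single i 1) 1"

definition simplicial_complex :: "nat \<Rightarrow> nat set set \<Rightarrow> bool" where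
  "simplicial_complex m \<Delta> \<longleftrightarrow>
     \<Delta> \<subseteq> Pow {1..m} \<and> {} \<in> \<Delta> \<and> (\<forall>F \<in> \<Delta>. \<forall>G. G \<subseteq> F \<longrightarrow> G \<in> \<Delta>)"

definition ghost_vertex :: "nat \<Rightarrow> nat set set \<Rightarrow> nat \<Rightarrow> bool" where
  "ghost_vertex m \<Delta> i \<longleftrightarrow> i \<in> {1..m} \<and> {i} \<notin> \<Delta>"

definition facets :: "nat set set \<Rightarrow> nat set set" where
  "facets \<Delta> = {F \<in> \<Delta>. \<forall>G \<in> \<Delta>. F \<subseteq> G \<longrightarrow> G = F}"

definition sr_ideal :: "nat \<Rightarrow> nat set set \<Rightarrow> ('k::field) mpoly set" where
  "sr_ideal m \<Delta> = genideal (poly_ring m) {\<Prod>i\<in>F. var i | F. F \<subseteq> {1..m} \<and> F \<notin> \<Delta>}"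

definition power_ideal :: "nat \<Rightarrow> (nat \<Rightarrow> nat) \<Rightarrow> ('k::field) mpoly set" where
  "power_ideal m n = genideal (poly_ring m) {var i ^ n i | i. i \<in> {1..m}}"

definition rel_ideal :: "nat \<Rightarrow> nat set set \<Rightarrow> (nat \<Rightarrow> nat) \<Rightarrow> ('k::field) mpoly set" where
  "rel_ideal m \<Delta> n = sr_ideal m \<Delta> <+>\<^bsub>poly_ring m\<^esub> power_ideal m n"

definition face_algebra ::
    "nat \<Rightarrow> nat set set \<Rightarrow> (nat \<Rightarrow> nat) \<Rightarrow> ('k::field) mpoly set ring" where
  "face_algebra m \<Delta> n = poly_ring m Quot rel_ideal m \<Delta> n"

definition residue_class ::
    "nat \<Rightarrow> nat set set \<Rightarrow> (nat \<Rightarrow> nat) \<Rightarrow> ('k::field) mpoly \<Rightarrow> 'k mpoly set" where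
  "residue_class m \<Delta> n p = rel_ideal m \<Delta> n +>\<^bsub>poly_ring m\<^esub> p"

text \<open>
  In the following definition \<open>s\<close> is the structure map of the algebra \<open>A\<close> over the field
  \<^typ>\<open>'k\<close>, that is, the scalar \<open>c\<close> acts on \<open>A\<close> as multiplication by \<open>s c\<close>. Linear forms are
  taken to be extensional on \<open>carrier A\<close>, so that equality in the module is equality of
  functions. The ring fields \<open>mult\<close> and \<open>one\<close> of the module record carry no meaning.
\<close>

definition canonical_module ::
    "('k::field \<Rightarrow> 'a) \<Rightarrow> ('a, 'b) ring_scheme \<Rightarrow> ('a, 'a \<Rightarrow> 'k) module" where
  "canonical_module s A = \<lparr>
     carrier = {l \<in> extensional (carrier A).
        (\<forall>a \<in> carrier A. \<forall>b \<in> carrier A. l (a \<oplus>\<^bsub>A\<^esub> b) = l a + l b) \<and>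
        (\<forall>c. \<forall>a \<in> carrier A. l (s c \<otimes>\<^bsub>A\<^esub> a) = c * l a)},
     monoid.mult = undefined, monoid.one = undefined,
     ring.zero = (\<lambda>b\<in>carrier A. 0),
     ring.add = (\<lambda>l l'. \<lambda>b\<in>carrier A. l b + l' b),
     smult = (\<lambda>a l. \<lambda>b\<in>carrier A. l (a \<otimes>\<^bsub>A\<^esub> b))\<rparr>"

text \<open>Module homomorphisms from \<open>M\<close> to the ring \<open>A\<close>, regarded as a module over itself.\<close>

definition hom_to_ring ::
    "('a, 'b) ring_scheme \<Rightarrow> ('a, 'c, 'd) module_scheme \<Rightarrow> ('c \<Rightarrow> 'a) set" where
  "hom_to_ring A M = {\<phi> \<in> carrier M \<rightarrow> carrier A.
     (\<forall>x \<in> carrier M. \<forall>y \<in> carrier M. \<phi> (x \<oplus>\<^bsub>M\<^esub> y) = \<phi> x \<oplus>\<^bsub>A\<^esub> \<phi> y) \<and>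
     (\<forall>a \<in> carrier A. \<forall>x \<in> carrier M. \<phi> (a \<odot>\<^bsub>M\<^esub> x) = a \<otimes>\<^bsub>A\<^esub> \<phi> x)}"

text \<open>
  The sum of an arbitrary (possibly infinite) family of ideals: the smallest ideal containing all
  of them. For two ideals this is \<open>I <+> J\<close>, by the library fact \<open>union_genideal\<close>.
\<close>

definition ideal_sum :: "('a, 'b) ring_scheme \<Rightarrow> 'i set \<Rightarrow> ('i \<Rightarrow> 'a set) \<Rightarrow> 'a set" where
  "ideal_sum A S J = genideal A (\<Union>i\<in>S. J i)"

definition trace_ideal :: "('a, 'b) ring_scheme \<Rightarrow> ('a, 'c, 'd) module_scheme \<Rightarrow> 'a set" where
  "trace_ideal A M = ideal_sum A (hom_to_ring A M) (\<lambda>\<phi>. \<phi> ` carrier M)"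

definition face_algebra_canonical_module ::
    "nat \<Rightarrow> nat set set \<Rightarrow> (nat \<Rightarrow> nat) \<Rightarrow> (('k::field) mpoly set, 'k mpoly set \<Rightarrow> 'k) module" where
  "face_algebra_canonical_module m \<Delta> n =
     canonical_module (\<lambda>c. residue_class m \<Delta> n (const c)) (face_algebra m \<Delta> n)"

definition D :: "nat set set \<Rightarrow> nat set \<Rightarrow> nat set \<Rightarrow> nat set" where
  "D \<C> K F = K \<union> (\<Union>\<C> - F)"

definition admissible :: "nat set set \<Rightarrow> nat set set \<Rightarrow> nat set \<Rightarrow> bool" where
  "admissible \<Delta> \<C> K \<longleftrightarrow>
     \<C> \<noteq> {} \<and> \<C> \<subseteq> facets \<Delta> \<and> K \<subseteq> \<Inter>\<C> \<and>
     (\<forall>F \<in> \<C>. D \<C> K F \<in> \<Delta>) \<and>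
     \<C> = {G \<in> facets \<Delta>. \<exists>F \<in> \<C>. D \<C> K F \<subseteq> G}"

definition J_ideal ::
    "nat \<Rightarrow> nat set set \<Rightarrow> (nat \<Rightarrow> nat) \<Rightarrow> nat set set \<Rightarrow> nat set \<Rightarrow> ('k::field) mpoly set set" where
  "J_ideal m \<Delta> n \<C> K = genideal (face_algebra m \<Delta> n)
     {residue_class m \<Delta> n ((\<Prod>i\<in>K. var i) * (\<Prod>j\<in>\<Union>\<C> - F. var j ^ (n j - 1))) | F. F \<in> \<C>}"


section \<open>Basic facts: the structures above are rings, ideals and modules\<close>

lemma poly_ring_simps [simp]:
  "monoid.mult (poly_ring m) = (*)" "monoid.one (poly_ring m) = 1"
  "ring.zero (poly_ring m) = 0" "ring.add (poly_ring m) = (+)"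
  by (simp_all add: poly_ring_def)

lemma poly_ring_carrier:
  "p \<in> carrier (poly_ring m) \<longleftrightarrow>
     (\<forall>t \<in> Poly_Mapping.keys p. Poly_Mapping.keys t \<subseteq> {1..m})"
  by (simp add: poly_ring_def)

lemma poly_ring_add_closed:
  assumes "p \<in> carrier (poly_ring m)" "q \<in> carrier (poly_ring m)"
  shows "p + q \<in> carrier (poly_ring m)"
  using assms Poly_Mapping.keys_add[of p q] unfolding poly_ring_carrier by blast

lemma poly_ring_mult_closed:
  assumes "p \<in> carrier (poly_ring m)" "q \<in> carrier (poly_ring m)"
  shows "p * q \<in> carrier (poly_ring m)"
  unfolding poly_ring_carrier
proof
  fix t assume "t \<in> Poly_Mapping.keys (p * q)"
  then obtain a b where "t = a + b" "a \<in> Poly_Mapping.keys p" "b \<in> Poly_Mapping.keys q"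
    using Poly_Mapping.keys_mult[of p q] by blast
  then show "Poly_Mapping.keys t \<subseteq> {1..m}"
    using assms Poly_Mapping.keys_add[of a b] unfolding poly_ring_carrier by blast
qed

lemma poly_ring_cring: "cring (poly_ring m :: ('k::field) mpoly ring)"
proof (rule cringI)
  show "abelian_group (poly_ring m :: 'k mpoly ring)"
  proof (rule abelian_groupI)
    fix p :: "'k mpoly" assume "p \<in> carrier (poly_ring m)"
    then show "\<exists>q \<in> carrier (poly_ring m). q \<oplus>\<^bsub>poly_ring m\<^esub> p = \<zero>\<^bsub>poly_ring m\<^esub>"
      by (intro bexI[of _ "- p"]) (auto simp: poly_ring_carrier)
  qed (simp_all add: poly_ring_add_closed algebra_simps, simp add: poly_ring_carrier)
  show "comm_monoid (poly_ring m :: 'k mpoly ring)"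
    by (rule comm_monoidI)
       (simp_all add: poly_ring_mult_closed algebra_simps, simp add: poly_ring_carrier)
qed (auto simp: algebra_simps)

lemma const_closed: "const c \<in> carrier (poly_ring m)"
  by (auto simp: poly_ring_carrier const_def)

lemma var_closed: "i \<in> {1..m} \<Longrightarrow> var i \<in> carrier (poly_ring m)"
  by (auto simp: poly_ring_carrier var_def)

lemma prod_closed:
  "(\<And>i. i \<in> F \<Longrightarrow> f i \<in> carrier (poly_ring m)) \<Longrightarrow> prod f F \<in> carrier (poly_ring m)"
  by (induction F rule: infinite_finite_induct)
     (auto simp: poly_ring_mult_closed, auto simp: poly_ring_carrier)

lemma power_closed:
  "p \<in> carrier (poly_ring m) \<Longrightarrow> p ^ k \<in> carrier (poly_ring m)"
  by (induction k) (auto simp: poly_ring_mult_closed, auto simp: poly_ring_carrier)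

lemma rel_ideal_ideal: "ideal (rel_ideal m \<Delta> n) (poly_ring m)"
proof -
  interpret P: cring "poly_ring m" by (rule poly_ring_cring)
  show ?thesis
    unfolding rel_ideal_def sr_ideal_def power_ideal_def
    by (intro P.add_ideals P.genideal_ideal)
       (auto intro!: prod_closed power_closed var_closed)
qed

lemma face_algebra_cring: "cring (face_algebra m \<Delta> n)"
  unfolding face_algebra_def
  by (rule ideal.quotient_is_cring[OF rel_ideal_ideal poly_ring_cring])

lemma residue_class_closed:
  "p \<in> carrier (poly_ring m) \<Longrightarrow> residue_class m \<Delta> n p \<in> carrier (face_algebra m \<Delta> n)"
  by (auto simp: residue_class_def face_algebra_def FactRing_def A_RCOSETS_def')

lemma residue_class_hom:
  "residue_class m \<Delta> n \<in> ring_hom (poly_ring m) (face_algebra m \<Delta> n)"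
  unfolding residue_class_def face_algebra_def
  by (rule ideal.rcos_ring_hom[OF rel_ideal_ideal])

lemma canonical_module_module:
  assumes "cring A" and s: "\<And>c. s c \<in> carrier A"
  shows "module A (canonical_module s A)"
proof -
  interpret A: cring A by fact
  have neg: "(\<lambda>b\<in>carrier A. - l b) \<in> carrier (canonical_module s A)"
    if "l \<in> carrier (canonical_module s A)" for l
    using that s by (auto simp: canonical_module_def)
  show ?thesis
  proof (rule moduleI)
    fix a l assume "a \<in> carrier A" "l \<in> carrier (canonical_module s A)"
    then show "a \<odot>\<^bsub>canonical_module s A\<^esub> l \<in> carrier (canonical_module s A)"
      using s by (auto simp: canonical_module_def A.r_distr A.m_lcomm[of a "s _"])
  next
    show "abelian_group (canonical_module s A)"
    proof (rule abelian_groupI)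
      fix l assume l: "l \<in> carrier (canonical_module s A)"
      show "\<exists>l' \<in> carrier (canonical_module s A).
          l' \<oplus>\<^bsub>canonical_module s A\<^esub> l = \<zero>\<^bsub>canonical_module s A\<^esub>"
        by (rule bexI[OF _ neg[OF l]]) (auto simp: canonical_module_def)
    qed (use s in \<open>auto simp: canonical_module_def algebra_simps extensional_def fun_eq_iff\<close>)
  qed (use s in \<open>auto simp: canonical_module_def A.r_distr A.l_distr A.m_ac fun_eq_iff
      extensional_def \<open>cring A\<close>\<close>)
qed

lemma face_algebra_canonical_module_module:
  "module (face_algebra m \<Delta> n) (face_algebra_canonical_module m \<Delta> n)"
  unfolding face_algebra_canonical_module_def
  by (intro canonical_module_module face_algebra_cring residue_class_closed const_closed)

end

theory Submission
  imports Defs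
begin

text \<open>
  The monomials \<open>x\<^sup>a\<close> with support a face and \<open>a\<^sub>i < n\<^sub>i\<close> form a basis of the algebra \<open>A\<close>; in terms
  of it and of the dual basis \<open>\<delta>\<^sub>b\<close> of the canonical module, a homomorphism is a matrix
  \<open>M b a\<close>, and linearity over \<open>A\<close> says that multiplying by a monomial may be moved from the
  column index to the row index. This condition is invariant under transposition.

  Write \<open>top F\<close> for the socle exponent of a facet \<open>F\<close>. If \<open>M (top F) a\<close> is nonzero, put
  \<open>d = a + top F\<close> and collect the facets \<open>G\<close> for which \<open>M (top G) (d - top G)\<close> or the transposed
  entry \<open>M (d - top G) (top G)\<close> is nonzero. Every facet containing the support of \<open>d - top F\<close>
  belongs to the transposed half, which makes this family, together with \<open>K = {i. n\<^sub>i \<le> d\<^sub>i}\<close>,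
  admissible; hence \<open>x\<^sup>a\<close> lies in its ideal. Conversely, an admissible pair gives
  \<open>d = top U + 1\<^sub>K\<close>, and mapping \<open>\<delta>\<^sub>b\<close> to \<open>x\<^bsup>d-b\<^esup>\<close> if \<open>b\<close> is supported on a member of the family, and
  to zero otherwise, is a homomorphism whose values at the \<open>\<delta>\<^bsub>top F\<^esub>\<close> are the generators.
\<close>

section \<open>Exponent vectors and polynomials\<close>

text \<open>Divisibility of monomials. Subtraction of exponent vectors is truncated at 0, so
  \<open>t - s\<close> is a true difference only when \<open>s \<preceq> t\<close>; hence the many
  case distinctions on this relation.\<close>

definition exp_le :: "(nat \<Rightarrow>\<^sub>0 nat) \<Rightarrow> (nat \<Rightarrow>\<^sub>0 nat) \<Rightarrow> bool"  (infix \<open>\<preceq>\<close> 50) where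
  "s \<preceq> t \<longleftrightarrow> (\<forall>i. Poly_Mapping.lookup s i \<le> Poly_Mapping.lookup t i)"

lemma exp_le_add [simp]: "s \<preceq> s + t" "s \<preceq> t + s"
  by (simp_all add: exp_le_def lookup_add)

lemma exp_diff_add: "s \<preceq> t \<Longrightarrow> t - s + s = t"
  by (rule poly_mapping_eqI) (simp add: exp_le_def lookup_add lookup_minus)

text \<open>Clears truncated subtraction from an equation, so that degree bookkeeping can be done
  with sums alone.\<close>

lemma exp_diff_add_eq_iff:
  assumes "s \<preceq> t"
  shows "t - s + u = v \<longleftrightarrow> t + u = v + s"
proof -
  have "t + u = (t - s + u) + s"
    by (subst exp_diff_add[OF assms, symmetric]) (simp add: add_ac)
  then show ?thesis
    by simp
qed

lemma exp_diff_diff: "s \<preceq> t \<Longrightarrow> t - (t - s) = s"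
  by (rule poly_mapping_eqI) (simp add: exp_le_def lookup_minus)

lemma exp_le_diff: "t - s \<preceq> t"
  by (simp add: exp_le_def lookup_minus)

lemma exp_le_keys: "s \<preceq> t \<Longrightarrow> Poly_Mapping.keys s \<subseteq> Poly_Mapping.keys t"
  unfolding exp_le_def in_keys_iff subset_iff by (metis le_zero_eq)

definition exp_on :: "nat set \<Rightarrow> (nat \<Rightarrow> nat) \<Rightarrow> (nat \<Rightarrow>\<^sub>0 nat)" where
  "exp_on S f = (\<Sum>i\<in>S. Poly_Mapping.single i (f i))"

lemma lookup_exp_on:
  "finite S \<Longrightarrow> Poly_Mapping.lookup (exp_on S f) i = (if i \<in> S then f i else 0)"
  by (simp add: exp_on_def lookup_sum lookup_single when_def)

lemma lookup_single_mult:
  fixes p :: "(nat \<Rightarrow>\<^sub>0 nat) \<Rightarrow>\<^sub>0 'k::comm_ring_1"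
  shows "Poly_Mapping.lookup (Poly_Mapping.single e c * p) t =
    (if e \<preceq> t then c * Poly_Mapping.lookup p (t - e) else 0)"
proof -
  have *: "Poly_Mapping.lookup (Poly_Mapping.single e c * p) t =
      c * (\<Sum>q. Poly_Mapping.lookup p q when t = e + q)"
    by (simp add: lookup_mult lookup_single when_mult)
  show ?thesis
  proof (cases "e \<preceq> t")
    case True
    then have "t = e + q \<longleftrightarrow> q = t - e" for q
      using exp_diff_add[OF True] by (auto simp: add.commute[of e])
    then show ?thesis
      using True by (simp add: *)
  next
    case False
    then have "t \<noteq> e + q" for q
      by auto
    then show ?thesis
      using False by (simp add: *)
  qed
qed

lemma poly_mapping_sum_single:
  fixes p :: "'a \<Rightarrow>\<^sub>0 'b::comm_monoid_add"
  shows
  "p = (\<Sum>t\<in>Poly_Mapping.keys p. Poly_Mapping.single t (Poly_Mapping.lookup p t))"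
  by (rule poly_mapping_eqI) (simp add: lookup_sum lookup_single when_def in_keys_iff)

text \<open>The induction runs over the terms of the fixed \<open>p\<close>, so the last case may
  use what is known about the exponents and coefficients occurring in \<open>p\<close>.\<close>

lemma poly_mapping_single_induct:
  fixes p :: "'a \<Rightarrow>\<^sub>0 'b::comm_monoid_add"
  assumes "P 0" "\<And>p q. P p \<Longrightarrow> P q \<Longrightarrow> P (p + q)"
    and "\<And>t. t \<in> Poly_Mapping.keys p \<Longrightarrow> P (Poly_Mapping.single t (Poly_Mapping.lookup p t))"
  shows "P p"
proof -
  have "P (\<Sum>t\<in>T. Poly_Mapping.single t (Poly_Mapping.lookup p t))"
    if "finite T" "T \<subseteq> Poly_Mapping.keys p" for T
    using that by (induction T rule: finite_induct) (auto intro: assms)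
  from this[OF finite_keys subset_refl] show ?thesis
    by (simp only: poly_mapping_sum_single[symmetric])
qed

lemma keys_exp_on: "finite S \<Longrightarrow> Poly_Mapping.keys (exp_on S f) = {i \<in> S. f i \<noteq> 0}"
  by (rule Set.set_eqI) (simp add: in_keys_iff lookup_exp_on)

lemma var_power: "(var i :: 'k::field mpoly) ^ k = Poly_Mapping.single (Poly_Mapping.single i k) 1"
proof (induction k)
  case 0
  show ?case by (simp only: power_0 single_zero single_one)
next
  case (Suc k)
  have "Poly_Mapping.single i 1 + Poly_Mapping.single i k = Poly_Mapping.single i (Suc k)"
    by (simp only: single_add[symmetric] plus_1_eq_Suc)
  then show ?case
    by (simp only: power_Suc Suc.IH) (simp only: var_def mult_single mult_1_left)
qed

lemma prod_var_power:
  "(\<Prod>i\<in>S. (var i :: 'k::field mpoly) ^ f i) = Poly_Mapping.single (exp_on S f) 1"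
  unfolding exp_on_def var_power
  by (induction S rule: infinite_finite_induct) (simp_all add: mult_single)

lemma prod_var:
  "(\<Prod>i\<in>S. var i :: 'k::field mpoly) = Poly_Mapping.single (exp_on S (\<lambda>_. 1)) 1"
  using prod_var_power[of "\<lambda>_. 1" S] by (simp only: power_one_right)

lemma single_mem_poly_ring:
  "Poly_Mapping.keys t \<subseteq> {1..m} \<Longrightarrow> Poly_Mapping.single t c \<in> carrier (poly_ring m)"
  by (simp add: poly_ring_carrier)

lemma poly_ring_minus:
  fixes p q :: "'k::field mpoly"
  assumes "p \<in> carrier (poly_ring m)" "q \<in> carrier (poly_ring m)"
  shows "p \<ominus>\<^bsub>poly_ring m\<^esub> q = p - q"
proof -
  interpret P: cring "poly_ring m :: 'k mpoly ring" by (rule poly_ring_cring)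
  have "- q \<in> carrier (poly_ring m)"
    using assms(2) by (auto simp: poly_ring_carrier)
  then have "\<ominus>\<^bsub>poly_ring m\<^esub> q = - q"
    using assms(2) by (intro P.minus_equality) auto
  then show ?thesis
    by (simp add: a_minus_def)
qed


section \<open>Admissible families\<close>

locale truncated_complex =
  fixes m :: nat and \<Delta> :: "nat set set" and n :: "nat \<Rightarrow> nat"
  assumes complex: "simplicial_complex m \<Delta>"
    and n_ge_2: "\<And>i. i \<in> {1..m} \<Longrightarrow> n i \<ge> 2"
begin

lemma face_vertices: "F \<in> \<Delta> \<Longrightarrow> F \<subseteq> {1..m}"
  using complex by (auto simp: simplicial_complex_def)

lemma face_subset: "F \<in> \<Delta> \<Longrightarrow> G \<subseteq> F \<Longrightarrow> G \<in> \<Delta>"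
  using complex by (auto simp: simplicial_complex_def)

lemma finite_face: "F \<in> \<Delta> \<Longrightarrow> finite F"
  using finite_subset[OF face_vertices] by simp

lemma facet_face: "F \<in> facets \<Delta> \<Longrightarrow> F \<in> \<Delta>"
  by (simp add: facets_def)

lemma face_in_facet:
  assumes "F \<in> \<Delta>"
  obtains G where "G \<in> facets \<Delta>" "F \<subseteq> G"
proof -
  have "finite {G \<in> \<Delta>. F \<subseteq> G}"
    by (rule finite_subset[of _ "Pow {1..m}"]) (use face_vertices in blast, simp)
  from finite_has_maximal2[OF this, of F] assms
  obtain G where G: "G \<in> \<Delta>" "F \<subseteq> G"
    and max: "\<forall>H \<in> {G \<in> \<Delta>. F \<subseteq> G}. G \<subseteq> H \<longrightarrow> G = H"
    by auto
  have "G \<in> facets \<Delta>"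
    unfolding facets_def
  proof (intro CollectI conjI ballI impI)
    fix H assume "H \<in> \<Delta>" "G \<subseteq> H"
    moreover have "F \<subseteq> H"
      using G(2) \<open>G \<subseteq> H\<close> by simp
    ultimately have "G = H"
      using max by blast
    then show "H = G"
      by (rule sym)
  qed (rule G(1))
  then show ?thesis
    using G(2) by (rule that)
qed

section \<open>Standard exponents and socle exponents\<close>

definition std_exps :: "(nat \<Rightarrow>\<^sub>0 nat) set" where
  "std_exps = {t. Poly_Mapping.keys t \<in> \<Delta> \<and>
     (\<forall>i \<in> Poly_Mapping.keys t. Poly_Mapping.lookup t i < n i)}"

lemma std_exps_face: "t \<in> std_exps \<Longrightarrow> Poly_Mapping.keys t \<in> \<Delta>"
  by (simp add: std_exps_def)

lemma std_exps_bound: "t \<in> std_exps \<Longrightarrow> Poly_Mapping.lookup t i \<le> n i - 1"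
  by (cases "i \<in> Poly_Mapping.keys t") (force simp: std_exps_def not_in_keys_iff_lookup_eq_zero)+

lemma std_expsI:
  assumes "Poly_Mapping.keys t \<in> \<Delta>" "\<And>i. Poly_Mapping.lookup t i \<le> n i - 1"
  shows "t \<in> std_exps"
  unfolding std_exps_def mem_Collect_eq
proof (intro conjI ballI)
  fix i assume "i \<in> Poly_Mapping.keys t"
  then have "n i \<ge> 2"
    using assms(1) face_vertices n_ge_2 by blast
  then show "Poly_Mapping.lookup t i < n i"
    using assms(2)[of i] by linarith
qed (rule assms(1))

lemma std_exps_le:
  assumes "t \<in> std_exps" "s \<preceq> t"
  shows "s \<in> std_exps"
proof (rule std_expsI)
  show "Poly_Mapping.keys s \<in> \<Delta>"
    using std_exps_face[OF assms(1)] exp_le_keys[OF assms(2)] by (rule face_subset)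
  show "Poly_Mapping.lookup s i \<le> n i - 1" for i
    using std_exps_bound[OF assms(1), of i] assms(2) unfolding exp_le_def by (meson le_trans)
qed

lemma finite_std_exps: "finite std_exps"
proof (rule finite_imageD)
  let ?f = "\<lambda>t :: nat \<Rightarrow>\<^sub>0 nat. restrict (Poly_Mapping.lookup t) {1..m}"
  have "?f ` std_exps \<subseteq> (\<Pi>\<^sub>E i\<in>{1..m}. {..n i - 1})"
    using std_exps_bound by (auto simp: image_subset_iff simp del: One_nat_def)
  then show "finite (?f ` std_exps)"
    by (rule finite_subset) (simp add: finite_PiE)
  show "inj_on ?f std_exps"
  proof (rule inj_onI, rule poly_mapping_eqI)
    fix s t i assume st: "s \<in> std_exps" "t \<in> std_exps" and eq: "?f s = ?f t"
    show "Poly_Mapping.lookup s i = Poly_Mapping.lookup t i"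
    proof (cases "i \<in> {1..m}")
      case True
      then show ?thesis
        using fun_cong[OF eq, of i] by simp
    next
      case False
      then have "i \<notin> Poly_Mapping.keys s" "i \<notin> Poly_Mapping.keys t"
        using st[THEN std_exps_face, THEN face_vertices] by blast+
      then show ?thesis
        by (simp add: in_keys_iff)
    qed
  qed
qed

text \<open>Also applied to unions of facets, which need not be faces and whose
  \<open>top_exp\<close> is then not standard.\<close>

definition top_exp :: "nat set \<Rightarrow> (nat \<Rightarrow>\<^sub>0 nat)" where
  "top_exp F = exp_on F (\<lambda>i. n i - 1)"

lemma lookup_top_exp:
  "F \<subseteq> {1..m} \<Longrightarrow> Poly_Mapping.lookup (top_exp F) i = (if i \<in> F then n i - 1 else 0)"
  unfolding top_exp_def by (rule lookup_exp_on) (rule finite_subset, auto)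

text \<open>Since \<open>n i \<ge> 2\<close>, every exponent \<open>n i - 1\<close> is positive, so
  no vertex drops out of the support.\<close>

lemma keys_top_exp: "F \<subseteq> {1..m} \<Longrightarrow> Poly_Mapping.keys (top_exp F) = F"
  using n_ge_2 by (fastforce simp: in_keys_iff lookup_top_exp split: if_splits simp del: One_nat_def)

lemma top_exp_std: "F \<in> \<Delta> \<Longrightarrow> top_exp F \<in> std_exps"
  using face_vertices[of F] by (intro std_expsI) (auto simp: keys_top_exp lookup_top_exp)

text \<open>The entries of a standard exponent never exceed \<open>n i - 1\<close>, so divisibility
  is decided by supports alone.\<close>

lemma exp_le_top_exp:
  "t \<in> std_exps \<Longrightarrow> F \<subseteq> {1..m} \<Longrightarrow> t \<preceq> top_exp F \<longleftrightarrow> Poly_Mapping.keys t \<subseteq> F"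
  using std_exps_bound[of t]
  by (auto simp: exp_le_def lookup_top_exp in_keys_iff subset_iff split: if_splits)

text \<open>
  The coefficients \<open>M b a\<close> of \<open>x\<^sup>a\<close> in the image of the dual basis vector of \<open>x\<^sup>b\<close>, under a
  homomorphism from the canonical module, are characterised by this condition.
\<close>

definition balanced :: "((nat \<Rightarrow>\<^sub>0 nat) \<Rightarrow> (nat \<Rightarrow>\<^sub>0 nat) \<Rightarrow> 'k::zero) \<Rightarrow> bool" where
  "balanced M \<longleftrightarrow> (\<forall>a \<in> std_exps. \<forall>b \<in> std_exps. \<forall>e.
     (if e \<preceq> a then M b (a - e) else 0) = (if e \<preceq> b then M (b - e) a else 0))"

lemma balancedD:
  "balanced M \<Longrightarrow> a \<in> std_exps \<Longrightarrow> b \<in> std_exps \<Longrightarrow>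
     (if e \<preceq> a then M b (a - e) else 0) = (if e \<preceq> b then M (b - e) a else 0)"
  by (simp add: balanced_def)

section \<open>Non-zero entries of balanced matrices\<close>

text \<open>Exchanging the indices swaps the two sides of the defining equation, so every fact about
  rows has a counterpart for columns.\<close>

lemma balanced_transpose: "balanced M \<Longrightarrow> balanced (\<lambda>a b. M b a)"
  by (simp add: balanced_def)

text \<open>In the balance condition at row \<open>top_exp F\<close> and column \<open>a\<close>,
  the choice \<open>e = top_exp F - b\<close> makes the right side \<open>M b a\<close>. Hence only
  the rows of socle exponents have to be studied.\<close>

lemma balanced_lift:
  assumes M: "balanced M" and F: "F \<in> \<Delta>" and b: "b \<in> std_exps" and a: "a \<in> std_exps"
    and "Poly_Mapping.keys b \<subseteq> F" "M b a \<noteq> 0"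
  obtains a' where "a' \<preceq> a" "M (top_exp F) a' \<noteq> 0"
proof -
  have le: "b \<preceq> top_exp F"
    using assms face_vertices exp_le_top_exp by blast
  let ?e = "top_exp F - b"
  have "top_exp F - ?e = b"
    by (rule exp_diff_diff[OF le])
  then have "(if ?e \<preceq> a then M (top_exp F) (a - ?e) else 0) \<noteq> 0"
    using balancedD[OF M a top_exp_std[OF F], of ?e] assms(6) by (simp add: exp_le_diff)
  then show ?thesis
    using that[OF exp_le_diff] by (metis (full_types))
qed

text \<open>Balance at row \<open>top_exp F\<close> and column \<open>top_exp G\<close> with
  \<open>e = top_exp G - a\<close> has left side \<open>M (top_exp F) a\<close>, and its right side
  is the entry sought. The sum of row and column index stays the same.\<close>

lemma balanced_switch:
  assumes M: "balanced M" and F: "F \<in> \<Delta>" and G: "G \<in> \<Delta>" and a: "a \<in> std_exps"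
    and "Poly_Mapping.keys a \<subseteq> G" "M (top_exp F) a \<noteq> 0"
  shows "\<exists>b \<in> std_exps. b + top_exp G = a + top_exp F \<and> M b (top_exp G) \<noteq> 0"
proof -
  have le: "a \<preceq> top_exp G"
    using assms face_vertices exp_le_top_exp by blast
  let ?e = "top_exp G - a"
  have *: "top_exp G - ?e = a"
    by (rule exp_diff_diff[OF le])
  then have "(if ?e \<preceq> top_exp F then M (top_exp F - ?e) (top_exp G) else 0) \<noteq> 0"
    using balancedD[OF M top_exp_std[OF G] top_exp_std[OF F], of ?e] assms(6)
    by (simp add: exp_le_diff)
  then have e: "?e \<preceq> top_exp F" "M (top_exp F - ?e) (top_exp G) \<noteq> 0"
    by (auto split: if_splits)
  have "top_exp F - ?e + top_exp G = a + top_exp F"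
  proof -
    have "a + top_exp F + ?e = (?e + a) + top_exp F"
      by (simp only: add_ac)
    also have "\<dots> = top_exp F + top_exp G"
      by (simp only: exp_diff_add[OF le] add.commute[of "top_exp G"])
    finally show ?thesis
      by (simp only: exp_diff_add_eq_iff[OF e(1)])
  qed
  then show ?thesis
    using e std_exps_le[OF top_exp_std[OF F] exp_le_diff] by blast
qed

text \<open>The balance condition relates only entries whose row and column indices have equal sum,
  so the matrix can be studied one multidegree \<open>d\<close> at a time.\<close>

definition alive :: "((nat \<Rightarrow>\<^sub>0 nat) \<Rightarrow> (nat \<Rightarrow>\<^sub>0 nat) \<Rightarrow> 'k::zero) \<Rightarrow> (nat \<Rightarrow>\<^sub>0 nat) \<Rightarrow> nat set set" where
  "alive M d = {F \<in> facets \<Delta>. \<exists>a \<in> std_exps. a + top_exp F = d \<and> M (top_exp F) a \<noteq> 0}"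

text \<open>Here \<open>d - top_exp F\<close> is the column index of the non-zero entry.
  \<open>balanced_switch\<close> yields an entry in column \<open>top_exp G\<close>, which is a row
  of the transpose.\<close>

lemma alive_switch:
  assumes "balanced M" "F \<in> alive M d" "G \<in> facets \<Delta>" "Poly_Mapping.keys (d - top_exp F) \<subseteq> G"
  shows "G \<in> alive (\<lambda>a b. M b a) d"
proof -
  obtain a where a: "a \<in> std_exps" "a + top_exp F = d" "M (top_exp F) a \<noteq> 0"
    and F: "F \<in> facets \<Delta>"
    using assms(2) by (auto simp: alive_def)
  then show ?thesis
    using balanced_switch[OF assms(1) facet_face[OF F] facet_face[OF assms(3)] a(1)] assms(3,4)
    by (auto simp: alive_def)
qed

text \<open>Switching interchanges the two halves of \<open>\<C>\<close>, so their union contains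
  every facet around the support of \<open>d - top_exp F\<close>, for each member \<open>F\<close>.
  This support turns out to be \<open>D \<C> K F\<close>, and the closure property becomes
  admissibility.\<close>

lemma balanced_admissible:
  assumes M: "balanced M" and F0: "F\<^sub>0 \<in> facets \<Delta>"
    and a: "a \<in> std_exps" "M (top_exp F\<^sub>0) a \<noteq> 0"
  obtains \<C> K where "admissible \<Delta> \<C> K" "F\<^sub>0 \<in> \<C>" "exp_on K (\<lambda>_. 1) + top_exp (\<Union>\<C> - F\<^sub>0) \<preceq> a"
proof -
  define d where "d = a + top_exp F\<^sub>0"
  define \<C> where "\<C> = alive M d \<union> alive (\<lambda>a b. M b a) d"
  \<comment> \<open>These vertices stay in the support after \<open>n i - 1\<close> is subtracted
    from \<open>d\<close>, even when they lie in the facet subtracted.\<close>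
  define K where "K = {i \<in> \<Union>\<C>. n i \<le> Poly_Mapping.lookup d i}"
  have F0C: "F\<^sub>0 \<in> \<C>"
    using F0 a by (auto simp: \<C>_def alive_def d_def)
  have facet: "F \<in> facets \<Delta>" if "F \<in> \<C>" for F
    using that by (auto simp: \<C>_def alive_def)
  have vert: "F \<subseteq> {1..m}" if "F \<in> \<C>" for F
    using facet[OF that] facet_face face_vertices by blast
  have std: "top_exp F \<preceq> d" "d - top_exp F \<in> std_exps" if "F \<in> \<C>" for F
    using that by (auto simp: \<C>_def alive_def)
  have switch: "G \<in> \<C>" if "F \<in> \<C>" "G \<in> facets \<Delta>" "Poly_Mapping.keys (d - top_exp F) \<subseteq> G" for F G
    using that alive_switch[OF M, of F d G] alive_switch[OF balanced_transpose[OF M], of F d G]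
    by (auto simp: \<C>_def)
  have n2: "n i \<ge> 2" if "i \<in> \<Union>\<C>" for i
    using that vert n_ge_2 by blast
  have d_ge: "n i - 1 \<le> Poly_Mapping.lookup d i" if "i \<in> \<Union>\<C>" for i
  proof -
    obtain F where "F \<in> \<C>" "i \<in> F"
      using \<open>i \<in> \<Union>\<C>\<close> by blast
    then show ?thesis
      using std(1)[of F] vert[of F] unfolding exp_le_def by (metis lookup_top_exp)
  qed
  \<comment> \<open>Outside \<open>F\<close> nothing is subtracted, so the entry of \<open>d\<close>
    is that of the standard exponent \<open>d - top_exp F\<close>.\<close>
  have d_le: "Poly_Mapping.lookup d i \<le> n i - 1" if "F \<in> \<C>" "i \<notin> F" for F i
    using std_exps_bound[OF std(2)[OF that(1)], of i] vert[OF that(1)] that(2)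
    by (simp add: lookup_minus lookup_top_exp)
  \<comment> \<open>A facet \<open>G\<close> around the support of
    \<open>d - top_exp F\<^sub>0\<close> lies in \<open>\<C>\<close>, so this support cannot leave
    \<open>\<Union>\<C>\<close>.\<close>
  have d_out: "Poly_Mapping.lookup d i = 0" if "i \<notin> \<Union>\<C>" for i
  proof -
    obtain G where G: "G \<in> facets \<Delta>" "Poly_Mapping.keys (d - top_exp F\<^sub>0) \<subseteq> G"
      using face_in_facet[OF std_exps_face[OF std(2)[OF F0C]]] by blast
    then have "i \<notin> G" "i \<notin> F\<^sub>0"
      using switch[OF F0C] F0C that by auto
    then have "i \<notin> Poly_Mapping.keys (d - top_exp F\<^sub>0)"
      using G by blast
    then show ?thesis
      using \<open>i \<notin> F\<^sub>0\<close> vert[OF F0C] by (simp add: in_keys_iff lookup_minus lookup_top_exp)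
  qed
  have K_sub: "K \<subseteq> F" if "F \<in> \<C>" for F
  proof
    fix i assume "i \<in> K"
    then show "i \<in> F"
      using d_le[OF that, of i] n2[of i] by (force simp: K_def)
  qed
  \<comment> \<open>At a vertex of \<open>F\<close>, the difference is positive exactly when
    \<open>n i \<le> d i\<close>, that is, on \<open>K\<close>. At a vertex of
    \<open>\<Union>\<C> - F\<close> it is at least \<open>n i - 1\<close>, hence positive.\<close>
  have keys: "Poly_Mapping.keys (d - top_exp F) = D \<C> K F" if F: "F \<in> \<C>" for F
  proof (rule Set.set_eqI)
    fix i
    show "i \<in> Poly_Mapping.keys (d - top_exp F) \<longleftrightarrow> i \<in> D \<C> K F"
    proof (cases "i \<in> \<Union>\<C>")
      case True
      then show ?thesis
        using n2[OF True] d_ge[OF True] K_sub[OF F] vert[OF F]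
        by (auto simp: D_def K_def in_keys_iff lookup_minus lookup_top_exp)
    next
      case False
      then show ?thesis
        using d_out[OF False] by (auto simp: D_def K_def in_keys_iff lookup_minus)
    qed
  qed
  \<comment> \<open>If a facet \<open>G\<close> contains \<open>\<Union>\<C> - F\<close>, then
    \<open>F\<close> contains \<open>\<Union>\<C> - G\<close>; with \<open>K \<subseteq> F\<close>
    this reverses the roles of \<open>F\<close> and \<open>G\<close>.\<close>
  have covered: "\<exists>G \<in> \<C>. D \<C> K G \<subseteq> F" if F: "F \<in> \<C>" for F
  proof -
    obtain G where G: "G \<in> facets \<Delta>" "Poly_Mapping.keys (d - top_exp F) \<subseteq> G"
      using face_in_facet[OF std_exps_face[OF std(2)[OF F]]] by blast
    then have "G \<in> \<C>" "D \<C> K G \<subseteq> F"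
      using switch[OF F] keys[OF F] K_sub[OF F] by (auto simp: D_def)
    then show ?thesis by blast
  qed
  have adm: "admissible \<Delta> \<C> K"
    unfolding admissible_def
  proof (intro conjI ballI)
    show "\<C> \<noteq> {}" "\<C> \<subseteq> facets \<Delta>" "K \<subseteq> \<Inter>\<C>"
      using F0C facet K_sub by blast+
    show "D \<C> K F \<in> \<Delta>" if "F \<in> \<C>" for F
      using std_exps_face[OF std(2)[OF that]] keys[OF that] by simp
    show "\<C> = {G \<in> facets \<Delta>. \<exists>F \<in> \<C>. D \<C> K F \<subseteq> G}"
    proof (intro equalityI subsetI)
      fix G assume "G \<in> \<C>"
      then show "G \<in> {G \<in> facets \<Delta>. \<exists>F \<in> \<C>. D \<C> K F \<subseteq> G}"
        using facet covered by blast
    next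
      fix G assume "G \<in> {G \<in> facets \<Delta>. \<exists>F \<in> \<C>. D \<C> K F \<subseteq> G}"
      then obtain F where "G \<in> facets \<Delta>" "F \<in> \<C>" "D \<C> K F \<subseteq> G"
        by blast
      then show "G \<in> \<C>"
        using switch keys by blast
    qed
  qed
  have finK: "finite K"
    using K_sub[OF F0C] finite_face[OF facet_face[OF F0]] by (rule finite_subset)
  have U: "\<Union>\<C> - F\<^sub>0 \<subseteq> {1..m}"
    using vert by blast
  have "exp_on K (\<lambda>_. 1) + top_exp (\<Union>\<C> - F\<^sub>0) \<preceq> d - top_exp F\<^sub>0"
    unfolding exp_le_def
  proof
    fix i
    \<comment> \<open>The bound on the left is 1 on \<open>K\<close>, \<open>n i - 1\<close> on
      \<open>\<Union>\<C> - F\<^sub>0\<close> and 0 elsewhere; the first two sets are disjoint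
      because \<open>K \<subseteq> F\<^sub>0\<close>.\<close>
    consider "i \<in> K" "i \<in> F\<^sub>0" | "i \<in> \<Union>\<C> - F\<^sub>0" "i \<notin> K" | "i \<notin> K" "i \<notin> \<Union>\<C> - F\<^sub>0"
      using K_sub[OF F0C] by blast
    then show "Poly_Mapping.lookup (exp_on K (\<lambda>_. 1) + top_exp (\<Union>\<C> - F\<^sub>0)) i
        \<le> Poly_Mapping.lookup (d - top_exp F\<^sub>0) i"
    proof cases
      case 1
      then have "n i \<le> Poly_Mapping.lookup d i" "n i \<ge> 2"
        using n2 by (auto simp: K_def)
      then show ?thesis
        using 1 by (simp add: lookup_add lookup_minus lookup_exp_on[OF finK]
            lookup_top_exp[OF U] lookup_top_exp[OF vert[OF F0C]])
    next
      case 2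
      then show ?thesis
        using d_ge[of i] by (simp add: lookup_add lookup_minus lookup_exp_on[OF finK]
            lookup_top_exp[OF U] lookup_top_exp[OF vert[OF F0C]])
    next
      case 3
      then show ?thesis
        by (auto simp: lookup_add lookup_exp_on[OF finK] lookup_top_exp[OF U])
    qed
  qed
  then show ?thesis
    using that[OF adm F0C] by (simp add: d_def)
qed

text \<open>The matrix sends the dual vector of \<open>x^b\<close> to \<open>x^(d - b)\<close> when
  \<open>b\<close> is supported on a member of \<open>\<C>\<close>. What has to be shown is that
  this support condition survives moving \<open>e\<close> from one index to the other; admissibility
  provides exactly that.\<close>

lemma admissible_balanced:
  fixes \<C> K
  assumes adm: "admissible \<Delta> \<C> K"
  defines "d \<equiv> exp_on K (\<lambda>_. 1) + top_exp (\<Union>\<C>)"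
  shows "balanced (\<lambda>b a. if (\<exists>F \<in> \<C>. Poly_Mapping.keys b \<subseteq> F) \<and> a + b = d then 1 else 0 :: 'k::zero_neq_one)"
    (is "balanced ?N")
proof -
  have ne: "\<C> \<noteq> {}" and sub: "\<C> \<subseteq> facets \<Delta>" and K_Int: "K \<subseteq> \<Inter>\<C>"
    and eq: "\<C> = {G \<in> facets \<Delta>. \<exists>F \<in> \<C>. D \<C> K F \<subseteq> G}"
    using adm[unfolded admissible_def, THEN conjunct1]
      adm[unfolded admissible_def, THEN conjunct2, THEN conjunct1]
      adm[unfolded admissible_def, THEN conjunct2, THEN conjunct2, THEN conjunct1]
      adm[unfolded admissible_def, THEN conjunct2, THEN conjunct2, THEN conjunct2, THEN conjunct2] .
  have facet: "F \<in> facets \<Delta>" if "F \<in> \<C>" for F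
    using that sub by blast
  have U: "\<Union>\<C> \<subseteq> {1..m}"
    using facet facet_face face_vertices by blast
  have closed: "G \<in> \<C>" if "F \<in> \<C>" "D \<C> K F \<subseteq> G" "G \<in> facets \<Delta>" for F G
    by (subst eq) (use that in blast)
  have K: "K \<subseteq> F" if "F \<in> \<C>" for F
    using that K_Int by blast
  have KU: "K \<subseteq> \<Union>\<C>"
    using ne K by blast
  have finK: "finite K"
    using U KU by (meson finite_subset finite_atLeastAtMost)
  have d: "Poly_Mapping.lookup d i = (if i \<in> K then n i else if i \<in> \<Union>\<C> then n i - 1 else 0)" for i
    using KU U n_ge_2[of i]
    by (fastforce simp: d_def lookup_add lookup_exp_on[OF finK] lookup_top_exp[OF U])
  have n2: "n i \<ge> 2" if "i \<in> \<Union>\<C>" for i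
    using that U n_ge_2 by blast
  \<comment> \<open>On \<open>K\<close> the sum is at least \<open>n i\<close> while
    \<open>b\<close> contributes at most \<open>n i - 1\<close>; on \<open>\<Union>\<C>\<close>
    outside the support of \<open>b\<close>, all of at least \<open>n i - 1 > 0\<close> comes from
    \<open>a\<close>.\<close>
  have supp: "K \<union> (\<Union>\<C> - Poly_Mapping.keys b) \<subseteq> Poly_Mapping.keys a"
    if "a + b = d + e" "b \<in> std_exps" for a b e
  proof
    fix i assume i: "i \<in> K \<union> (\<Union>\<C> - Poly_Mapping.keys b)"
    have "Poly_Mapping.lookup a i + Poly_Mapping.lookup b i
        = Poly_Mapping.lookup d i + Poly_Mapping.lookup e i"
      using that(1) by (metis lookup_add)
    moreover have "n i \<ge> 2"
      using i KU n2 by blast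
    ultimately show "i \<in> Poly_Mapping.keys a"
      using i std_exps_bound[OF that(2), of i]
      by (cases "i \<in> K") (auto simp: d in_keys_iff)
  qed
  \<comment> \<open>A facet around the support of \<open>a\<close> contains
    \<open>D \<C> K F\<close> by \<open>supp\<close>, so it belongs to \<open>\<C>\<close>.\<close>
  have in_U: "Poly_Mapping.keys a \<subseteq> \<Union>\<C>"
    if *: "a + b = d + e" "a \<in> std_exps" "b \<in> std_exps" "F \<in> \<C>" "Poly_Mapping.keys b \<subseteq> F" for a b e F
  proof -
    obtain G where G: "G \<in> facets \<Delta>" "Poly_Mapping.keys a \<subseteq> G"
      using face_in_facet[OF std_exps_face[OF *(2)]] by blast
    moreover have "D \<C> K F \<subseteq> G"
      using supp[OF *(1,3)] *(5) G(2) by (auto simp: D_def)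
    ultimately show ?thesis
      using closed[OF *(4)] by blast
  qed
  \<comment> \<open>Either side gives \<open>a + b = d + e\<close>. The work lies in deriving
    divisibility by \<open>e\<close> and the support condition on the other side.\<close>
  have iff: "(e \<preceq> a \<and> (\<exists>F \<in> \<C>. Poly_Mapping.keys b \<subseteq> F) \<and> a - e + b = d) \<longleftrightarrow>
        (e \<preceq> b \<and> (\<exists>F \<in> \<C>. Poly_Mapping.keys (b - e) \<subseteq> F) \<and> a + (b - e) = d)" (is "?L \<longleftrightarrow> ?R")
    if a: "a \<in> std_exps" and b: "b \<in> std_exps" for a b e
  proof
    assume L: ?L
    then obtain F where F: "F \<in> \<C>" "Poly_Mapping.keys b \<subseteq> F"
      by blast
    have sum: "a + b = d + e"
      using L exp_diff_add_eq_iff[of e a b d] by blast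
    have "e \<preceq> b"
      unfolding exp_le_def
    proof
      fix i
      have *: "Poly_Mapping.lookup a i + Poly_Mapping.lookup b i = Poly_Mapping.lookup d i + Poly_Mapping.lookup e i"
        using sum by (metis lookup_add)
      \<comment> \<open>On \<open>\<Union>\<C>\<close> the entry of \<open>a\<close> is at most
        \<open>n i - 1\<close>, hence at most that of \<open>d\<close>; elsewhere it is 0. Either
        way \<open>b\<close> absorbs all of \<open>e\<close>.\<close>
      show "Poly_Mapping.lookup e i \<le> Poly_Mapping.lookup b i"
      proof (cases "i \<in> \<Union>\<C>")
        case True
        then have "n i - 1 \<le> Poly_Mapping.lookup d i"
          by (auto simp: d)
        then show ?thesis
          using * std_exps_bound[OF a, of i] by linarith
      next
        case False
        then have "Poly_Mapping.lookup a i = 0"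
          using in_U[OF sum a b F] by (meson in_keys_iff subsetD)
        then show ?thesis using * by linarith
      qed
    qed
    moreover have "a + (b - e) = d"
      using sum exp_diff_add_eq_iff[OF calculation, of a d] by (metis add.commute)
    ultimately show ?R
      using F exp_le_keys[OF exp_le_diff[of b e]] by blast
  next
    assume R: ?R
    then obtain F where F: "F \<in> \<C>" "Poly_Mapping.keys (b - e) \<subseteq> F"
      by blast
    have sum: "a + b = d + e"
      using R exp_diff_add_eq_iff[of e b a d] by (metis add.commute)
    have be: "b - e \<in> std_exps"
      using std_exps_le[OF b exp_le_diff] .
    have sum': "b - e + a = d + 0" "a + (b - e) = d + 0"
      using R by (simp_all add: add.commute)
    \<comment> \<open>Admissibility is used twice: it puts the facet \<open>H\<close> around the
      support of \<open>a\<close> into \<open>\<C>\<close>, and then, starting from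
      \<open>H\<close>, the facet \<open>G\<close> around the support of \<open>b\<close>. For this
      \<open>supp\<close> is applied to \<open>a\<close> and \<open>b - e\<close> in both orders,
      with its \<open>e\<close> equal to 0.\<close>
    obtain G where G: "G \<in> facets \<Delta>" "Poly_Mapping.keys b \<subseteq> G"
      using face_in_facet[OF std_exps_face[OF b]] by blast
    obtain H where H: "H \<in> facets \<Delta>" "Poly_Mapping.keys a \<subseteq> H"
      using face_in_facet[OF std_exps_face[OF a]] by blast
    have "D \<C> K F \<subseteq> H"
      using supp[OF sum'(2) be] F(2) H(2) by (auto simp: D_def)
    then have "H \<in> \<C>"
      using closed[OF F(1) _ H(1)] by blast
    moreover have "D \<C> K H \<subseteq> G"
      using supp[OF sum'(1) a] H(2) G(2) exp_le_keys[OF exp_le_diff[of b e]]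
      unfolding D_def by blast
    ultimately have "G \<in> \<C>"
      using closed G(1) by blast
    have "e \<preceq> a"
      unfolding exp_le_def
    proof
      fix i
      have *: "Poly_Mapping.lookup a i + Poly_Mapping.lookup b i = Poly_Mapping.lookup d i + Poly_Mapping.lookup e i"
        using sum by (metis lookup_add)
      have "Poly_Mapping.lookup b i \<le> Poly_Mapping.lookup d i"
      proof (cases "i \<in> Poly_Mapping.keys b")
        case True
        then have "i \<in> \<Union>\<C>"
          using G(2) \<open>G \<in> \<C>\<close> by blast
        then show ?thesis
          using std_exps_bound[OF b, of i] by (auto simp: d)
      qed (simp add: in_keys_iff)
      then show "Poly_Mapping.lookup e i \<le> Poly_Mapping.lookup a i"
        using * by linarith
    qed
    moreover have "a - e + b = d"
      using sum exp_diff_add_eq_iff[OF calculation, of b d] by blast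
    ultimately show ?L
      using \<open>G \<in> \<C>\<close> G(2) by blast
  qed
  show ?thesis
    unfolding balanced_def
  proof (intro ballI allI)
    fix a b e assume "a \<in> std_exps" "b \<in> std_exps"
    from iff[OF this, of e]
    show "(if e \<preceq> a then ?N b (a - e) else 0) = (if e \<preceq> b then ?N (b - e) a else 0)"
      by argo
  qed
qed


section \<open>The monomial basis of the algebra\<close>

abbreviation res :: "'k::field mpoly \<Rightarrow> 'k mpoly set" where
  "res \<equiv> residue_class m \<Delta> n"

abbreviation mon :: "(nat \<Rightarrow>\<^sub>0 nat) \<Rightarrow> 'k::field mpoly set" where
  "mon t \<equiv> res (Poly_Mapping.single t 1)"

abbreviation alg :: "'k::field mpoly set ring" where
  "alg \<equiv> face_algebra m \<Delta> n"

abbreviation omega :: "('k::field mpoly set, 'k mpoly set \<Rightarrow> 'k) module" where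
  "omega \<equiv> face_algebra_canonical_module m \<Delta> n"

section \<open>The relation ideal as the span of non-standard monomials\<close>

definition nonstd_polys :: "'k::field mpoly set" where
  "nonstd_polys = {p \<in> carrier (poly_ring m). \<forall>t \<in> std_exps. Poly_Mapping.lookup p t = 0}"

text \<open>Standard exponents are closed under divisors, so a standard monomial in a product
  \<open>x * a\<close> can only come from a standard monomial of \<open>a\<close>.\<close>

lemma nonstd_polys_ideal: "ideal (nonstd_polys :: 'k::field mpoly set) (poly_ring m)"
proof -
  interpret P: cring "poly_ring m :: 'k mpoly ring" by (rule poly_ring_cring)
  have mult: "x * a \<in> nonstd_polys"
    if a: "a \<in> nonstd_polys" and x: "x \<in> carrier (poly_ring m)" for a x :: "'k mpoly"
  proof -
    have "Poly_Mapping.lookup (x * a) t = 0" if t: "t \<in> std_exps" for t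
    proof (rule ccontr)
      assume "Poly_Mapping.lookup (x * a) t \<noteq> 0"
      then have "t \<in> Poly_Mapping.keys (x * a)"
        by (simp add: in_keys_iff)
      then obtain u v where uv: "t = u + v" "v \<in> Poly_Mapping.keys a"
        using Poly_Mapping.keys_mult[of x a] by blast
      then have "v \<in> std_exps"
        using std_exps_le[OF t] by simp
      then show False
        using uv(2) a by (simp add: nonstd_polys_def in_keys_iff)
    qed
    then show ?thesis
      using a x by (simp add: nonstd_polys_def poly_ring_mult_closed)
  qed
  have carr: "p \<in> carrier (poly_ring m)" if "p \<in> nonstd_polys" for p :: "'k mpoly"
    using that by (simp add: nonstd_polys_def)
  show ?thesis
  proof (rule idealI[OF P.ring_axioms])
    show "subgroup (nonstd_polys :: 'k mpoly set) (add_monoid (poly_ring m))"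
    proof (rule P.add.subgroupI)
      show "nonstd_polys \<subseteq> carrier (poly_ring m :: 'k mpoly ring)"
        using carr by blast
      have "0 \<in> (nonstd_polys :: 'k mpoly set)"
        by (simp add: nonstd_polys_def poly_ring_carrier)
      then show "(nonstd_polys :: 'k mpoly set) \<noteq> {}"
        by blast
    next
      fix a :: "'k mpoly" assume a: "a \<in> nonstd_polys"
      have neg: "- a \<in> carrier (poly_ring m)"
        using carr[OF a] by (simp add: poly_ring_carrier in_keys_iff)
      have "\<ominus>\<^bsub>poly_ring m\<^esub> a = - a"
        using carr[OF a] neg by (intro P.minus_equality) simp_all
      then show "\<ominus>\<^bsub>poly_ring m\<^esub> a \<in> nonstd_polys"
        using a neg by (simp add: nonstd_polys_def)
    next
      fix a b :: "'k mpoly" assume "a \<in> nonstd_polys" "b \<in> nonstd_polys"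
      then show "a \<oplus>\<^bsub>poly_ring m\<^esub> b \<in> nonstd_polys"
        by (simp add: nonstd_polys_def lookup_add poly_ring_add_closed)
    qed
    fix a x :: "'k mpoly" assume ax: "a \<in> nonstd_polys" "x \<in> carrier (poly_ring m)"
    show "x \<otimes>\<^bsub>poly_ring m\<^esub> a \<in> nonstd_polys"
      using mult[OF ax] by simp
    show "a \<otimes>\<^bsub>poly_ring m\<^esub> x \<in> nonstd_polys"
      using mult[OF ax] by (simp add: mult.commute)
  qed
qed

lemma single_nonstd:
  assumes "Poly_Mapping.keys t \<subseteq> {1..m}" "t \<notin> std_exps"
  shows "Poly_Mapping.single t c \<in> nonstd_polys"
  unfolding nonstd_polys_def mem_Collect_eq
proof (intro conjI ballI)
  show "Poly_Mapping.single t c \<in> carrier (poly_ring m)"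
    by (rule single_mem_poly_ring[OF assms(1)])
  show "Poly_Mapping.lookup (Poly_Mapping.single t c) s = 0" if "s \<in> std_exps" for s
    using that assms(2) by (intro lookup_single_not_eq) metis
qed

lemma sr_gen_nonstd:
  assumes "F \<subseteq> {1..m}" "F \<notin> \<Delta>"
  shows "(\<Prod>i\<in>F. var i :: 'k::field mpoly) \<in> nonstd_polys"
  unfolding prod_var
proof (rule single_nonstd)
  have "finite F"
    using assms(1) by (rule finite_subset) simp
  then have keys: "Poly_Mapping.keys (exp_on F (\<lambda>_. 1)) = F"
    by (simp add: keys_exp_on)
  show "Poly_Mapping.keys (exp_on F (\<lambda>_. 1)) \<subseteq> {1..m}"
    unfolding keys by (rule assms(1))
  show "exp_on F (\<lambda>_. 1) \<notin> std_exps"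
    using std_exps_face[of "exp_on F (\<lambda>_. 1)"] assms(2) unfolding keys by blast
qed

lemma power_gen_nonstd:
  assumes "i \<in> {1..m}"
  shows "(var i :: 'k::field mpoly) ^ n i \<in> nonstd_polys"
  unfolding var_power
proof (rule single_nonstd)
  show "Poly_Mapping.keys (Poly_Mapping.single i (n i)) \<subseteq> {1..m}"
    using assms by simp
  show "Poly_Mapping.single i (n i) \<notin> std_exps"
  proof
    assume "Poly_Mapping.single i (n i) \<in> std_exps"
    from std_exps_bound[OF this, of i] show False
      using n_ge_2[OF assms] by simp
  qed
qed

text \<open>One inclusion is checked on the generators, the other term by term: a non-standard
  monomial is divisible by a generator.\<close>

lemma rel_ideal_eq: "(rel_ideal m \<Delta> n :: 'k::field mpoly set) = nonstd_polys"
proof -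
  interpret P: cring "poly_ring m :: 'k mpoly ring" by (rule poly_ring_cring)
  interpret I: ideal "rel_ideal m \<Delta> n :: 'k mpoly set" "poly_ring m" by (rule rel_ideal_ideal)
  let ?S = "{\<Prod>i\<in>F. var i | F. F \<subseteq> {1..m} \<and> F \<notin> \<Delta>} :: 'k mpoly set"
  let ?T = "{var i ^ n i | i. i \<in> {1..m}} :: 'k mpoly set"
  have carr: "?S \<subseteq> carrier (poly_ring m)" "?T \<subseteq> carrier (poly_ring m)"
    by (auto intro!: prod_closed power_closed var_closed)
  have idl: "ideal (sr_ideal m \<Delta> :: 'k mpoly set) (poly_ring m)"
      "ideal (power_ideal m n :: 'k mpoly set) (poly_ring m)"
    unfolding sr_ideal_def power_ideal_def using carr by (simp_all add: P.genideal_ideal)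
  have rel: "rel_ideal m \<Delta> n = genideal (poly_ring m) (sr_ideal m \<Delta> \<union> power_ideal m n :: 'k mpoly set)"
    unfolding rel_ideal_def using P.union_genideal[OF idl] by simp
  have gens: "?S \<union> ?T \<subseteq> rel_ideal m \<Delta> n"
    unfolding rel using P.genideal_self[OF carr(1)] P.genideal_self[OF carr(2)]
      P.genideal_self[of "sr_ideal m \<Delta> \<union> power_ideal m n"] idl[THEN ideal.Icarr]
    unfolding sr_ideal_def power_ideal_def by blast
  show ?thesis
  proof
    show "(rel_ideal m \<Delta> n :: 'k mpoly set) \<subseteq> nonstd_polys"
      unfolding rel
    proof (rule P.genideal_minimal[OF nonstd_polys_ideal], rule Un_least)
      show "sr_ideal m \<Delta> \<subseteq> (nonstd_polys :: 'k mpoly set)"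
        unfolding sr_ideal_def
        by (rule P.genideal_minimal[OF nonstd_polys_ideal]) (use sr_gen_nonstd in blast)
      show "power_ideal m n \<subseteq> (nonstd_polys :: 'k mpoly set)"
        unfolding power_ideal_def
        by (rule P.genideal_minimal[OF nonstd_polys_ideal]) (use power_gen_nonstd in blast)
    qed
  next
    show "nonstd_polys \<subseteq> (rel_ideal m \<Delta> n :: 'k mpoly set)"
    proof
      fix p :: "'k mpoly" assume p: "p \<in> nonstd_polys"
      show "p \<in> rel_ideal m \<Delta> n"
      proof (rule poly_mapping_single_induct[of "\<lambda>p. p \<in> rel_ideal m \<Delta> n" p])
        show "0 \<in> (rel_ideal m \<Delta> n :: 'k mpoly set)"
          using I.zero_closed by simp
        show "q + r \<in> rel_ideal m \<Delta> n"
          if "q \<in> rel_ideal m \<Delta> n" "r \<in> rel_ideal m \<Delta> n" for q r :: "'k mpoly"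
          using I.a_closed[OF that] by simp
        fix t assume t: "t \<in> Poly_Mapping.keys p"
        let ?c = "Poly_Mapping.lookup p t"
        have vert: "Poly_Mapping.keys t \<subseteq> {1..m}" and "t \<notin> std_exps"
          using t p by (auto simp: nonstd_polys_def poly_ring_carrier in_keys_iff)
        \<comment> \<open>The generator dividing \<open>x^t\<close> is \<open>x_i^(n i)\<close> for
          an exponent that is too large if the support is a face, and the squarefree monomial on the
          support otherwise.\<close>
        obtain g where g: "Poly_Mapping.single g 1 \<in> (rel_ideal m \<Delta> n :: 'k mpoly set)" "g \<preceq> t"
        proof (cases "Poly_Mapping.keys t \<in> \<Delta>")
          case True
          then obtain i where i: "i \<in> Poly_Mapping.keys t" "n i \<le> Poly_Mapping.lookup t i"
            using \<open>t \<notin> std_exps\<close> by (auto simp: std_exps_def not_less)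
          have "(var i :: 'k mpoly) ^ n i \<in> rel_ideal m \<Delta> n"
            using gens i(1) vert by blast
          moreover have "Poly_Mapping.single i (n i) \<preceq> t"
            using i(2) by (simp add: exp_le_def lookup_single when_def)
          ultimately show ?thesis
            using that by (simp add: var_power)
        next
          case False
          then have "(\<Prod>i\<in>Poly_Mapping.keys t. var i :: 'k mpoly) \<in> rel_ideal m \<Delta> n"
            using gens vert by blast
          moreover have "exp_on (Poly_Mapping.keys t) (\<lambda>_. 1) \<preceq> t"
            by (auto simp: exp_le_def lookup_exp_on in_keys_iff)
          ultimately show ?thesis
            using that by (simp add: prod_var)
        qed
        have "Poly_Mapping.single (t - g) ?c \<in> carrier (poly_ring m)"
          using vert exp_le_keys[OF exp_le_diff[of t g]] by (intro single_mem_poly_ring) blast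
        from I.I_l_closed[OF g(1) this]
        show "Poly_Mapping.single t ?c \<in> rel_ideal m \<Delta> n"
          by (simp add: mult_single exp_diff_add[OF g(2)])
      qed
    qed
  qed
qed

section \<open>Coefficients with respect to the monomial basis\<close>

lemma res_eq_iff:
  fixes p q :: "'k::field mpoly"
  assumes "p \<in> carrier (poly_ring m)" "q \<in> carrier (poly_ring m)"
  shows "res p = res q \<longleftrightarrow> (\<forall>t \<in> std_exps. Poly_Mapping.lookup p t = Poly_Mapping.lookup q t)"
proof -
  interpret P: cring "poly_ring m :: 'k mpoly ring" by (rule poly_ring_cring)
  have "res p = res q \<longleftrightarrow> p \<ominus>\<^bsub>poly_ring m\<^esub> q \<in> rel_ideal m \<Delta> n"
    unfolding residue_class_def
    using P.quotient_eq_iff_same_a_r_cos[OF rel_ideal_ideal assms] by simp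
  moreover have "p - q \<in> carrier (poly_ring m)"
    using P.minus_closed[OF assms] by (simp add: poly_ring_minus assms)
  ultimately show ?thesis
    by (simp add: rel_ideal_eq nonstd_polys_def poly_ring_minus assms lookup_minus)
qed

lemma carrier_alg: "carrier alg = res ` (carrier (poly_ring m) :: 'k::field mpoly set)"
  by (auto simp: residue_class_def face_algebra_def FactRing_def A_RCOSETS_def')

lemma res_add:
  "p \<in> carrier (poly_ring m) \<Longrightarrow> q \<in> carrier (poly_ring m) \<Longrightarrow> res (p + q) = res p \<oplus>\<^bsub>alg\<^esub> res q"
  using ring_hom_add[OF residue_class_hom[of m \<Delta> n], of p q] by simp

lemma res_mult:
  "p \<in> carrier (poly_ring m) \<Longrightarrow> q \<in> carrier (poly_ring m) \<Longrightarrow> res (p * q) = res p \<otimes>\<^bsub>alg\<^esub> res q"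
  using ring_hom_mult[OF residue_class_hom[of m \<Delta> n], of p q] by simp

lemma res_zero: "res 0 = \<zero>\<^bsub>alg\<^esub>"
  using ring_hom_zero[OF residue_class_hom] poly_ring_cring face_algebra_cring
  by (metis cring.axioms(1) poly_ring_simps(3))

text \<open>Coefficient of \<open>x^t\<close> in a chosen representative. By
  \<open>res_eq_iff\<close> it is independent of the choice for standard \<open>t\<close>, and only
  such \<open>t\<close> are meaningful.\<close>

definition cf :: "(nat \<Rightarrow>\<^sub>0 nat) \<Rightarrow> 'k::field mpoly set \<Rightarrow> 'k" where
  "cf t z = Poly_Mapping.lookup (SOME p. p \<in> carrier (poly_ring m) \<and> res p = z) t"

lemma cf_res:
  assumes "p \<in> carrier (poly_ring m)" "t \<in> std_exps"
  shows "cf t (res p) = Poly_Mapping.lookup p t"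
proof -
  let ?q = "SOME q. q \<in> carrier (poly_ring m) \<and> res q = res p"
  have "?q \<in> carrier (poly_ring m) \<and> res ?q = res p"
    by (rule someI[of _ p]) (simp add: assms)
  then show ?thesis
    using res_eq_iff[of ?q p] assms by (simp add: cf_def)
qed

lemma alg_eqI:
  assumes "z \<in> carrier alg" "w \<in> carrier alg" "\<And>t. t \<in> std_exps \<Longrightarrow> cf t z = cf t w"
  shows "z = w"
proof -
  obtain p q where "p \<in> carrier (poly_ring m)" "z = res p" "q \<in> carrier (poly_ring m)" "w = res q"
    using assms(1,2) by (auto simp: carrier_alg)
  then show ?thesis
    using assms(3) by (simp add: cf_res res_eq_iff)
qed

lemma cf_add:
  assumes "z \<in> carrier alg" "w \<in> carrier alg" "t \<in> std_exps"
  shows "cf t (z \<oplus>\<^bsub>alg\<^esub> w) = cf t z + cf t w"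
  using assms by (auto simp: carrier_alg cf_res poly_ring_add_closed lookup_add simp flip: res_add)

lemma cf_zero: "t \<in> std_exps \<Longrightarrow> cf t \<zero>\<^bsub>alg\<^esub> = 0"
  by (simp add: cf_res poly_ring_carrier flip: res_zero)

lemma cf_single_mult:
  assumes "z \<in> carrier alg" "t \<in> std_exps" "Poly_Mapping.keys e \<subseteq> {1..m}"
  shows "cf t (res (Poly_Mapping.single e c) \<otimes>\<^bsub>alg\<^esub> z) = (if e \<preceq> t then c * cf (t - e) z else 0)"
proof -
  obtain p where p: "p \<in> carrier (poly_ring m)" "z = res p"
    using assms(1) by (auto simp: carrier_alg)
  have "t - e \<in> std_exps"
    using std_exps_le[OF assms(2) exp_le_diff] .
  then show ?thesis
    using p assms single_mem_poly_ring[OF assms(3), of c]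
    by (simp add: cf_res lookup_single_mult poly_ring_mult_closed flip: res_mult)
qed

lemma std_exps_vertices: "t \<in> std_exps \<Longrightarrow> Poly_Mapping.keys t \<subseteq> {1..m}"
  using std_exps_face face_vertices by blast

lemma single_std_closed: "t \<in> std_exps \<Longrightarrow> Poly_Mapping.single t c \<in> carrier (poly_ring m)"
  by (intro single_mem_poly_ring std_exps_vertices)

lemma res_single_nonstd:
  assumes "Poly_Mapping.keys t \<subseteq> {1..m}" "t \<notin> std_exps"
  shows "res (Poly_Mapping.single t c) = \<zero>\<^bsub>alg\<^esub>"
proof -
  have "res (Poly_Mapping.single t c) = res 0"
    using assms
    by (subst res_eq_iff)
       (auto simp: single_mem_poly_ring lookup_single when_def poly_ring_carrier)
  then show ?thesis by (simp add: res_zero)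
qed

lemma res_single:
  assumes "Poly_Mapping.keys t \<subseteq> {1..m}"
  shows "res (Poly_Mapping.single t c) = res (const c) \<otimes>\<^bsub>alg\<^esub> mon t"
  using assms by (simp add: single_mem_poly_ring const_closed mult_single const_def flip: res_mult)

text \<open>Non-standard terms of a representative vanish in the algebra, and each remaining term is
  a scalar multiple of a monomial in \<open>R\<close>.\<close>

lemma mem_ideal_if_monomials:
  assumes R: "ideal R alg" and z: "z \<in> carrier alg"
    and mon: "\<And>t. t \<in> std_exps \<Longrightarrow> cf t z \<noteq> 0 \<Longrightarrow> mon t \<in> R"
  shows "z \<in> (R :: 'k::field mpoly set set)"
proof -
  interpret R: ideal R "alg :: 'k mpoly set ring" by (rule R)
  obtain p where p: "p \<in> carrier (poly_ring m)" "z = res p"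
    using z by (auto simp: carrier_alg)
  have "p \<in> carrier (poly_ring m) \<and> res p \<in> R"
  proof (rule poly_mapping_single_induct[of "\<lambda>p. p \<in> carrier (poly_ring m) \<and> res p \<in> R" p])
    show "0 \<in> carrier (poly_ring m) \<and> res 0 \<in> R"
      by (simp add: res_zero R.zero_closed poly_ring_carrier)
    show "q + r \<in> carrier (poly_ring m) \<and> res (q + r) \<in> R"
      if "q \<in> carrier (poly_ring m) \<and> res q \<in> R" "r \<in> carrier (poly_ring m) \<and> res r \<in> R"
      for q r :: "'k mpoly"
      using that by (simp add: res_add poly_ring_add_closed)
    fix t assume t: "t \<in> Poly_Mapping.keys p"
    let ?c = "Poly_Mapping.lookup p t"
    have vert: "Poly_Mapping.keys t \<subseteq> {1..m}"
      using t p(1) by (simp add: poly_ring_carrier)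
    have "res (Poly_Mapping.single t ?c) \<in> R"
    proof (cases "t \<in> std_exps")
      case True
      then have "mon t \<in> R"
        using mon[OF True] t p by (simp add: cf_res in_keys_iff)
      then show ?thesis
        using R.I_l_closed[OF _ residue_class_closed[OF const_closed]]
        by (subst res_single[OF vert]) blast
    qed (simp add: res_single_nonstd[OF vert] R.zero_closed)
    then show "Poly_Mapping.single t ?c \<in> carrier (poly_ring m)
        \<and> res (Poly_Mapping.single t ?c) \<in> R"
      by (simp add: single_mem_poly_ring[OF vert])
  qed
  then show ?thesis by (simp add: p)
qed


section \<open>Homomorphisms from the canonical module\<close>

lemma omega_carrier:
  "l \<in> carrier omega \<longleftrightarrow> l \<in> extensional (carrier alg) \<and>
     (\<forall>z \<in> carrier alg. \<forall>w \<in> carrier alg. l (z \<oplus>\<^bsub>alg\<^esub> w) = l z + l w) \<and>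
     (\<forall>c. \<forall>z \<in> carrier alg. l (res (const c) \<otimes>\<^bsub>alg\<^esub> z) = c * l z)"
  by (simp add: face_algebra_canonical_module_def canonical_module_def)

lemma omega_simps:
  "\<zero>\<^bsub>omega\<^esub> = (\<lambda>z\<in>carrier alg. 0)"
  "l \<oplus>\<^bsub>omega\<^esub> l' = (\<lambda>z\<in>carrier alg. l z + l' z)"
  "w \<odot>\<^bsub>omega\<^esub> l = (\<lambda>z\<in>carrier alg. l (w \<otimes>\<^bsub>alg\<^esub> z))"
  by (simp_all add: face_algebra_canonical_module_def canonical_module_def)

text \<open>Vectors of the dual basis, restricted because linear forms in \<open>omega\<close> are
  extensional.\<close>

definition dual :: "(nat \<Rightarrow>\<^sub>0 nat) \<Rightarrow> 'k::field mpoly set \<Rightarrow> 'k" where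
  "dual b = (\<lambda>z\<in>carrier alg. cf b z)"

lemma dual_closed:
  assumes "b \<in> std_exps"
  shows "(dual b :: 'k::field mpoly set \<Rightarrow> 'k) \<in> carrier omega"
proof -
  interpret A: cring "alg :: 'k mpoly set ring" by (rule face_algebra_cring)
  have "cf b (res (const c) \<otimes>\<^bsub>alg\<^esub> z) = c * cf b z" if "z \<in> carrier alg" for c :: 'k and z
    using cf_single_mult[OF that assms, of 0 c] by (simp add: const_def exp_le_def)
  moreover have "res (const c) \<otimes>\<^bsub>alg\<^esub> z \<in> carrier alg" if "z \<in> carrier alg" for c :: 'k and z
    using A.m_closed[OF residue_class_closed[OF const_closed] that] .
  ultimately show ?thesis
    by (simp add: omega_carrier dual_def cf_add assms)
qed

lemma mon_closed: "Poly_Mapping.keys t \<subseteq> {1..m} \<Longrightarrow> res (Poly_Mapping.single t c) \<in> carrier alg"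
  by (intro residue_class_closed single_mem_poly_ring)

lemma std_mon_closed: "t \<in> std_exps \<Longrightarrow> res (Poly_Mapping.single t c) \<in> carrier alg"
  by (intro mon_closed std_exps_vertices)

text \<open>Monomials act on the dual basis by contraction, as in Macaulay's inverse
  systems.\<close>

lemma mon_smult_dual:
  assumes "b \<in> std_exps" "Poly_Mapping.keys e \<subseteq> {1..m}"
  shows "mon e \<odot>\<^bsub>omega\<^esub> dual b = (if e \<preceq> b then dual (b - e) else (\<zero>\<^bsub>omega\<^esub> :: 'k::field mpoly set \<Rightarrow> 'k))"
proof -
  interpret A: cring "alg :: 'k mpoly set ring" by (rule face_algebra_cring)
  have "mon e \<otimes>\<^bsub>alg\<^esub> z \<in> carrier alg" if "z \<in> carrier alg" for z :: "'k mpoly set"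
    using A.m_closed[OF mon_closed[OF assms(2)] that] .
  then show ?thesis
    by (cases "e \<preceq> b")
       (simp_all add: omega_simps(1,3) dual_def cf_single_mult[OF _ assms] cong: restrict_cong)
qed

lemma dual_mon:
  "b \<in> std_exps \<Longrightarrow> t \<in> std_exps \<Longrightarrow> dual b (mon t) = (if t = b then 1 else 0)"
  unfolding dual_def
  by (subst restrict_apply', rule std_mon_closed, assumption)
     (simp add: cf_res[OF single_std_closed] lookup_single when_def)

lemma omega_eval_zero:
  assumes "l \<in> carrier omega"
  shows "l \<zero>\<^bsub>alg\<^esub> = (0 :: 'k::field)"
proof -
  interpret A: cring "alg :: 'k mpoly set ring" by (rule face_algebra_cring)
  have "l (\<zero>\<^bsub>alg\<^esub> \<oplus>\<^bsub>alg\<^esub> \<zero>\<^bsub>alg\<^esub>) = l \<zero>\<^bsub>alg\<^esub> + l \<zero>\<^bsub>alg\<^esub>"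
    using assms A.zero_closed unfolding omega_carrier by blast
  then have "l \<zero>\<^bsub>alg\<^esub> + l \<zero>\<^bsub>alg\<^esub> = l \<zero>\<^bsub>alg\<^esub> + 0"
    by (simp only: A.l_zero A.zero_closed add_0_right)
  then show ?thesis
    by (simp only: add_left_cancel)
qed

lemma omega_zeroI:
  assumes l: "l \<in> carrier omega" and "\<And>t. t \<in> std_exps \<Longrightarrow> l (mon t) = 0"
  shows "l = (\<zero>\<^bsub>omega\<^esub> :: 'k::field mpoly set \<Rightarrow> 'k)"
proof -
  interpret A: cring "alg :: 'k mpoly set ring" by (rule face_algebra_cring)
  note zero = omega_eval_zero[OF l]
  have "l z = 0" if z: "z \<in> carrier alg" for z
  proof -
    obtain p where p: "p \<in> carrier (poly_ring m)" "z = res p"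
      using z by (auto simp: carrier_alg)
    have "p \<in> carrier (poly_ring m) \<and> l (res p) = 0"
    proof (rule poly_mapping_single_induct[of "\<lambda>p. p \<in> carrier (poly_ring m) \<and> l (res p) = 0" p])
      show "0 \<in> carrier (poly_ring m) \<and> l (res 0) = 0"
        by (simp add: res_zero zero poly_ring_carrier)
      show "q + r \<in> carrier (poly_ring m) \<and> l (res (q + r)) = 0"
        if "q \<in> carrier (poly_ring m) \<and> l (res q) = 0" "r \<in> carrier (poly_ring m) \<and> l (res r) = 0"
        for q r :: "'k mpoly"
        using that l by (simp add: res_add poly_ring_add_closed omega_carrier residue_class_closed)
      fix t assume t: "t \<in> Poly_Mapping.keys p"
      have vert: "Poly_Mapping.keys t \<subseteq> {1..m}"
        using t p(1) by (simp add: poly_ring_carrier)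
      have "l (res (Poly_Mapping.single t c)) = 0" for c
      proof (cases "t \<in> std_exps")
        case True
        then show ?thesis
          using l assms(2)[OF True] mon_closed[OF vert, of "1 :: 'k"]
          by (subst res_single[OF vert]) (simp add: omega_carrier)
      qed (simp add: res_single_nonstd[OF vert] zero)
      then show "Poly_Mapping.single t (Poly_Mapping.lookup p t) \<in> carrier (poly_ring m)
          \<and> l (res (Poly_Mapping.single t (Poly_Mapping.lookup p t))) = 0"
        by (simp add: single_mem_poly_ring[OF vert])
    qed
    then show ?thesis by (simp add: p)
  qed
  then have "restrict l (carrier alg) = (\<lambda>z\<in>carrier alg. 0)"
    by (intro restrict_ext) simp
  then show ?thesis
    using l by (simp add: omega_carrier omega_simps(1) extensional_restrict)
qed

text \<open>The dual vectors span the canonical module over the field, so the image of a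
  homomorphism is controlled by their images.\<close>

lemma hom_image_in_ideal:
  fixes \<phi> :: "('k::field mpoly set \<Rightarrow> 'k) \<Rightarrow> 'k mpoly set"
  assumes \<phi>: "\<phi> \<in> hom_to_ring alg omega" and R: "ideal R alg"
    and dual: "\<And>b. b \<in> std_exps \<Longrightarrow> \<phi> (dual b) \<in> R" and l: "l \<in> carrier omega"
  shows "\<phi> l \<in> R"
proof -
  interpret A: cring "alg :: 'k mpoly set ring" by (rule face_algebra_cring)
  interpret W: module "alg :: 'k mpoly set ring" omega by (rule face_algebra_canonical_module_module)
  interpret R: ideal R "alg :: 'k mpoly set ring" by (rule R)
  have add: "\<phi> (x \<oplus>\<^bsub>omega\<^esub> y) = \<phi> x \<oplus>\<^bsub>alg\<^esub> \<phi> y" if "x \<in> carrier omega" "y \<in> carrier omega" for x y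
    using \<phi> that by (simp add: hom_to_ring_def)
  have smult: "\<phi> (a \<odot>\<^bsub>omega\<^esub> x) = a \<otimes>\<^bsub>alg\<^esub> \<phi> x" if "a \<in> carrier alg" "x \<in> carrier omega" for a x
    using \<phi> that by (simp add: hom_to_ring_def)
  have closed: "\<phi> x \<in> carrier alg" if "x \<in> carrier omega" for x
    using \<phi> that unfolding hom_to_ring_def by blast
  have const: "res (const c) \<in> carrier alg" for c :: 'k
    by (rule residue_class_closed[OF const_closed])
  \<comment> \<open>Generalised to forms vanishing on the standard monomials outside
    \<open>T\<close>, so that induction can remove one dual vector at a time.\<close>
  have "\<phi> l \<in> R" if "finite T" "T \<subseteq> std_exps" "l \<in> carrier omega" "\<And>t. t \<in> std_exps - T \<Longrightarrow> l (mon t) = 0" for T l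
    using that
  proof (induction T arbitrary: l rule: finite_induct)
    case empty
    then have "l = \<zero>\<^bsub>omega\<^esub>"
      using omega_zeroI[OF empty(2)] by simp
    then have "\<phi> l = \<phi> (\<zero>\<^bsub>alg\<^esub> \<odot>\<^bsub>omega\<^esub> l)"
      using empty by simp
    also have "\<dots> = \<zero>\<^bsub>alg\<^esub> \<otimes>\<^bsub>alg\<^esub> \<phi> l"
      by (rule smult[OF A.zero_closed empty(2)])
    also have "\<dots> = \<zero>\<^bsub>alg\<^esub>"
      by (rule A.l_null[OF closed[OF empty(2)]])
    finally show ?case
      using R.zero_closed by simp
  next
    case (insert b T)
    have b: "b \<in> std_exps"
      using insert.prems(1) by simp
    note db = dual_closed[where 'k = 'k, OF b]
    define c where "c = l (mon b)"
    \<comment> \<open>Subtracting the component of \<open>l\<close> along \<open>dual b\<close>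
      makes the form vanish at \<open>x^b\<close> as well.\<close>
    define l' where "l' = l \<oplus>\<^bsub>omega\<^esub> (res (const (- c)) \<odot>\<^bsub>omega\<^esub> dual b)"
    have l': "l' \<in> carrier omega"
      unfolding l'_def
      by (rule W.M.a_closed[OF insert.prems(2) W.smult_closed[OF const db]])
    have scale: "(res (const d) \<odot>\<^bsub>omega\<^esub> dual b) z = d * dual b z" if "z \<in> carrier alg" for d :: 'k and z
      using that db by (simp add: omega_simps omega_carrier)
    have l'_eval: "l' z = l z - c * dual b z" if "z \<in> carrier alg" for z
      unfolding l'_def using that scale[OF that, of "- c"] by (simp add: omega_simps(2))
    have "l' \<oplus>\<^bsub>omega\<^esub> (res (const c) \<odot>\<^bsub>omega\<^esub> dual b) = l"
    proof
      fix z
      show "(l' \<oplus>\<^bsub>omega\<^esub> (res (const c) \<odot>\<^bsub>omega\<^esub> dual b)) z = l z"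
        using insert.prems(2) l'_eval[of z] scale[of z c]
        by (cases "z \<in> carrier alg") (auto simp: omega_simps(2) omega_carrier extensional_def)
    qed
    then have "\<phi> l = \<phi> l' \<oplus>\<^bsub>alg\<^esub> (res (const c) \<otimes>\<^bsub>alg\<^esub> \<phi> (dual b))"
      using add[OF l', of "res (const c) \<odot>\<^bsub>omega\<^esub> dual b"] smult[OF const db, of c]
        W.smult_closed[OF const db, of c] by simp
    moreover have "\<phi> l' \<in> R"
    proof (rule insert.IH[OF _ l'])
      show "T \<subseteq> std_exps"
        using insert.prems(1) by simp
    next
      fix t assume t: "t \<in> std_exps - T"
      then have "l' (mon t) = l (mon t) - c * dual b (mon t)"
        by (intro l'_eval mon_closed std_exps_vertices) simp
      then show "l' (mon t) = 0"
        using t insert.prems(3)[of t] by (cases "t = b") (auto simp: dual_mon b c_def)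
    qed
    ultimately show ?case
      using dual[OF b] const R.I_l_closed by simp
  qed
  from this[OF finite_std_exps subset_refl l] show ?thesis by simp
qed

text \<open>Compares the coefficients of \<open>x^a\<close> in
  \<open>\<phi> (x^e \<odot> dual b)\<close> and in \<open>x^e\<close> times
  \<open>\<phi> (dual b)\<close>.\<close>

lemma hom_balanced:
  fixes \<phi> :: "('k::field mpoly set \<Rightarrow> 'k) \<Rightarrow> 'k mpoly set"
  assumes \<phi>: "\<phi> \<in> hom_to_ring alg omega"
  shows "balanced (\<lambda>b a. cf a (\<phi> (dual b)))"
  unfolding balanced_def
proof (intro ballI allI)
  fix a b e assume a: "a \<in> std_exps" and b: "b \<in> std_exps"
  interpret A: cring "alg :: 'k mpoly set ring" by (rule face_algebra_cring)
  interpret W: module "alg :: 'k mpoly set ring" omega by (rule face_algebra_canonical_module_module)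
  have smult: "\<phi> (x \<odot>\<^bsub>omega\<^esub> l) = x \<otimes>\<^bsub>alg\<^esub> \<phi> l" if "x \<in> carrier alg" "l \<in> carrier omega" for x l
    using \<phi> that by (simp add: hom_to_ring_def)
  have closed: "\<phi> l \<in> carrier alg" if "l \<in> carrier omega" for l
    using \<phi> that by (auto simp: hom_to_ring_def)
  have zero: "\<phi> \<zero>\<^bsub>omega\<^esub> = \<zero>\<^bsub>alg\<^esub>"
    using smult[OF A.zero_closed W.zero_closed] closed[OF W.zero_closed] by simp
  show "(if e \<preceq> a then cf (a - e) (\<phi> (dual b)) else 0) = (if e \<preceq> b then cf a (\<phi> (dual (b - e))) else 0)"
  \<comment> \<open>The balance condition ranges over all \<open>e\<close>. If \<open>e\<close>
    involves an indeterminate outside \<open>{1..m}\<close>, it divides neither standard exponent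
    and both sides are 0.\<close>
  proof (cases "Poly_Mapping.keys e \<subseteq> {1..m}")
    case True
    have "cf a (\<phi> (mon e \<odot>\<^bsub>omega\<^esub> dual b)) = (if e \<preceq> a then cf (a - e) (\<phi> (dual b)) else 0)"
      using cf_single_mult[OF closed[OF dual_closed[where 'k = 'k, OF b]] a True, of 1]
        smult[OF mon_closed[OF True, of "1 :: 'k"] dual_closed[where 'k = 'k, OF b]] by simp
    then show ?thesis
      using mon_smult_dual[where 'k = 'k, OF b True] by (simp add: zero cf_zero[OF a] split: if_splits)
  next
    case False
    then have "\<not> e \<preceq> a" "\<not> e \<preceq> b"
      using exp_le_keys std_exps_vertices a b by blast+
    then show ?thesis by simp
  qed
qed

section \<open>Homomorphisms given by balanced matrices\<close>

text \<open>Matrix times vector: the values \<open>l (mon b)\<close> are the coordinates of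
  \<open>l\<close> in the dual basis.\<close>

definition matrix_hom ::
    "((nat \<Rightarrow>\<^sub>0 nat) \<Rightarrow> (nat \<Rightarrow>\<^sub>0 nat) \<Rightarrow> 'k::field) \<Rightarrow> ('k mpoly set \<Rightarrow> 'k) \<Rightarrow> 'k mpoly set" where
  "matrix_hom M l = res (\<Sum>a\<in>std_exps. Poly_Mapping.single a (\<Sum>b\<in>std_exps. M b a * l (mon b)))"

lemma sum_single_closed:
  "(\<Sum>a\<in>std_exps. Poly_Mapping.single a (f a)) \<in> carrier (poly_ring m)"
proof -
  have "(\<Sum>a\<in>T. Poly_Mapping.single a (f a)) \<in> carrier (poly_ring m)"
    if "finite T" "T \<subseteq> std_exps" for T
    using that
    by (induction T rule: finite_induct)
       (auto intro: poly_ring_add_closed single_std_closed, simp add: poly_ring_carrier)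
  then show ?thesis
    using finite_std_exps by blast
qed

lemma matrix_hom_closed: "matrix_hom M l \<in> carrier alg"
  unfolding matrix_hom_def by (intro residue_class_closed sum_single_closed)

lemma cf_matrix_hom:
  "t \<in> std_exps \<Longrightarrow> cf t (matrix_hom M l) = (\<Sum>b\<in>std_exps. M b t * l (mon b))"
  by (simp add: matrix_hom_def cf_res[OF sum_single_closed] lookup_sum lookup_single when_def
      finite_std_exps)

text \<open>Converse to \<open>hom_balanced\<close>: linearity is checked for multiplication by a
  single term, where it is the balance condition, and extends to all polynomials by
  additivity.\<close>

lemma matrix_hom_hom:
  fixes M :: "(nat \<Rightarrow>\<^sub>0 nat) \<Rightarrow> (nat \<Rightarrow>\<^sub>0 nat) \<Rightarrow> 'k::field"
  assumes M: "balanced M"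
  shows "matrix_hom M \<in> hom_to_ring alg omega"
proof -
  interpret A: cring "alg :: 'k mpoly set ring" by (rule face_algebra_cring)
  interpret W: module "alg :: 'k mpoly set ring" omega by (rule face_algebra_canonical_module_module)
  note closed = std_mon_closed
  have add: "matrix_hom M (l \<oplus>\<^bsub>omega\<^esub> l') = matrix_hom M l \<oplus>\<^bsub>alg\<^esub> matrix_hom M l'" for l l'
    by (rule alg_eqI)
       (simp_all add: matrix_hom_closed cf_add cf_matrix_hom omega_simps(2) closed
         distrib_left sum.distrib)
  note zero = omega_eval_zero
  have single: "matrix_hom M (res (Poly_Mapping.single e c) \<odot>\<^bsub>omega\<^esub> l)
      = res (Poly_Mapping.single e c) \<otimes>\<^bsub>alg\<^esub> matrix_hom M l"
    if e: "Poly_Mapping.keys e \<subseteq> {1..m}" and l: "l \<in> carrier omega" for e c l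
  proof (rule alg_eqI)
    fix a assume a: "a \<in> std_exps"
    have eval: "l (res (Poly_Mapping.single e c) \<otimes>\<^bsub>alg\<^esub> mon b)
        = (if e + b \<in> std_exps then c * l (mon (e + b)) else 0)" if b: "b \<in> std_exps" for b
    proof -
      have keys: "Poly_Mapping.keys (e + b) \<subseteq> {1..m}"
        using Poly_Mapping.keys_add[of e b] e std_exps_vertices[OF b] by blast
      have "res (Poly_Mapping.single e c) \<otimes>\<^bsub>alg\<^esub> mon b = res (Poly_Mapping.single (e + b) c)"
        using e b by (simp add: mult_single single_std_closed single_mem_poly_ring flip: res_mult)
      moreover have "l (res (const c) \<otimes>\<^bsub>alg\<^esub> mon (e + b)) = c * l (mon (e + b))"
        using l mon_closed[OF keys] unfolding omega_carrier by blast
      ultimately show ?thesis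
        using res_single[OF keys, of c] res_single_nonstd[OF keys, of c] zero[OF l] by auto
    qed
    have "cf a (matrix_hom M (res (Poly_Mapping.single e c) \<odot>\<^bsub>omega\<^esub> l))
        = (\<Sum>b\<in>std_exps. M b a * l (res (Poly_Mapping.single e c) \<otimes>\<^bsub>alg\<^esub> mon b))"
      by (simp add: cf_matrix_hom a omega_simps(3) closed)
    \<comment> \<open>Products with \<open>e + b\<close> not standard are zero; what remains is
      reindexed by \<open>e + b\<close>, after which balance can be applied in each summand.\<close>
    also have "\<dots> = (\<Sum>b\<in>{b \<in> std_exps. e + b \<in> std_exps}. M b a * (c * l (mon (e + b))))"
      by (intro sum.mono_neutral_cong_right) (auto simp: finite_std_exps eval)
    also have "\<dots> = (\<Sum>b\<in>{b \<in> std_exps. e \<preceq> b}. M (b - e) a * (c * l (mon b)))"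
      by (rule sum.reindex_bij_witness[where i = "\<lambda>b. b - e" and j = "\<lambda>b. e + b"])
         (auto simp: exp_diff_add add.commute[of e] intro: std_exps_le[OF _ exp_le_diff])
    also have "\<dots> = (\<Sum>b\<in>std_exps. (if e \<preceq> b then M (b - e) a else 0) * (c * l (mon b)))"
      by (intro sum.mono_neutral_cong_left) (auto simp: finite_std_exps)
    also have "\<dots> = (\<Sum>b\<in>std_exps. (if e \<preceq> a then M b (a - e) else 0) * (c * l (mon b)))"
      by (intro sum.cong refl) (simp only: balancedD[OF M a])
    also have "\<dots> = (if e \<preceq> a then c * cf (a - e) (matrix_hom M l) else 0)"
      by (simp add: cf_matrix_hom std_exps_le[OF a exp_le_diff] sum_distrib_left mult_ac)
    finally show "cf a (matrix_hom M (res (Poly_Mapping.single e c) \<odot>\<^bsub>omega\<^esub> l))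
        = cf a (res (Poly_Mapping.single e c) \<otimes>\<^bsub>alg\<^esub> matrix_hom M l)"
      by (simp add: cf_single_mult[OF matrix_hom_closed a e])
  next
    show "res (Poly_Mapping.single e c) \<otimes>\<^bsub>alg\<^esub> matrix_hom M l \<in> carrier alg"
      by (rule A.m_closed[OF mon_closed[OF e] matrix_hom_closed])
  qed (rule matrix_hom_closed)
  have "matrix_hom M (z \<odot>\<^bsub>omega\<^esub> l) = z \<otimes>\<^bsub>alg\<^esub> matrix_hom M l"
    if z: "z \<in> carrier alg" and l: "l \<in> carrier omega" for z l
  proof -
    obtain p where p: "p \<in> carrier (poly_ring m)" "z = res p"
      using z by (auto simp: carrier_alg)
    let ?Q = "\<lambda>p. p \<in> carrier (poly_ring m) \<and> matrix_hom M (res p \<odot>\<^bsub>omega\<^esub> l) = res p \<otimes>\<^bsub>alg\<^esub> matrix_hom M l"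
    have "?Q p"
    proof (rule poly_mapping_single_induct[of ?Q p])
      \<comment> \<open>The zero polynomial is the term with exponent 0 and coefficient 0.\<close>
      show "?Q 0"
        using single[OF _ l, of 0 0] by (simp add: poly_ring_carrier)
      show "?Q (q + r)" if "?Q q" "?Q r" for q r
        using that l add
        by (simp add: res_add poly_ring_add_closed residue_class_closed W.smult_l_distr
            A.l_distr matrix_hom_closed)
      show "?Q (Poly_Mapping.single t (Poly_Mapping.lookup p t))" if "t \<in> Poly_Mapping.keys p" for t
        using that p(1) single[OF _ l, of t] single_mem_poly_ring[of t]
        by (auto simp: poly_ring_carrier)
    qed
    then show ?thesis by (simp add: p)
  qed
  then show ?thesis
    by (auto simp: hom_to_ring_def matrix_hom_closed add)
qed

lemma trace_ideal_ideal: "ideal (trace_ideal alg (omega :: ('k::field mpoly set, _) module)) alg"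
  and trace_idealI: "\<phi> \<in> hom_to_ring alg omega \<Longrightarrow> l \<in> carrier (omega :: ('k mpoly set, _) module)
    \<Longrightarrow> \<phi> l \<in> trace_ideal alg omega"
proof -
  interpret A: cring "alg :: 'k mpoly set ring" by (rule face_algebra_cring)
  have sub: "(\<Union>\<phi> \<in> hom_to_ring alg omega. \<phi> ` carrier omega) \<subseteq> carrier (alg :: 'k mpoly set ring)"
    by (auto simp: hom_to_ring_def)
  show "ideal (trace_ideal alg (omega :: ('k::field mpoly set, _) module)) alg"
    unfolding trace_ideal_def ideal_sum_def by (rule A.genideal_ideal[OF sub])
  show "\<phi> l \<in> trace_ideal alg omega"
    if "\<phi> \<in> hom_to_ring alg omega" "l \<in> carrier (omega :: ('k mpoly set, _) module)"
    using that A.genideal_self[OF sub] unfolding trace_ideal_def ideal_sum_def by blast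
qed

section \<open>The generators of the ideals of admissible pairs and the two inclusions\<close>

lemma generator_eq:
  "(\<Prod>i\<in>K. var i) * (\<Prod>j\<in>U - F. var j ^ (n j - 1)) =
    (Poly_Mapping.single (exp_on K (\<lambda>_. 1) + top_exp (U - F)) 1 :: 'k::field mpoly)"
  by (simp add: prod_var prod_var_power top_exp_def mult_single)

lemma generator_vertices:
  assumes "admissible \<Delta> \<C> K" "F \<in> \<C>"
  shows "finite K" "\<Union>\<C> \<subseteq> {1..m}" "K \<subseteq> F" "F \<in> facets \<Delta>"
    "Poly_Mapping.keys (exp_on K (\<lambda>_. 1) + top_exp (\<Union>\<C> - F)) = D \<C> K F"
proof -
  have sub: "\<C> \<subseteq> facets \<Delta>" and "K \<subseteq> \<Inter>\<C>"
    using assms(1)[unfolded admissible_def, THEN conjunct2, THEN conjunct1]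
      assms(1)[unfolded admissible_def, THEN conjunct2, THEN conjunct2, THEN conjunct1] .
  then show F: "K \<subseteq> F" "F \<in> facets \<Delta>"
    using assms(2) by blast+
  show U: "\<Union>\<C> \<subseteq> {1..m}"
    using sub facet_face face_vertices by blast
  show K: "finite K"
    using F(1) finite_face[OF facet_face[OF F(2)]] by (rule finite_subset)
  have U': "\<Union>\<C> - F \<subseteq> {1..m}"
    using U by blast
  have "i \<in> Poly_Mapping.keys (exp_on K (\<lambda>_. 1) + top_exp (\<Union>\<C> - F)) \<longleftrightarrow>
      i \<in> K \<or> i \<in> Poly_Mapping.keys (top_exp (\<Union>\<C> - F))" for i
    by (simp add: in_keys_iff lookup_add lookup_exp_on[OF K])
  then show "Poly_Mapping.keys (exp_on K (\<lambda>_. 1) + top_exp (\<Union>\<C> - F)) = D \<C> K F"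
    by (auto simp: D_def keys_top_exp[OF U'])
qed

text \<open>The support is \<open>D \<C> K F\<close>, a face by admissibility. The sets
  \<open>K\<close> and \<open>\<Union>\<C> - F\<close> are disjoint, and the exponent 1 on
  \<open>K\<close> is allowed because \<open>n i \<ge> 2\<close>.\<close>

lemma generator_std:
  assumes "admissible \<Delta> \<C> K" "F \<in> \<C>"
  shows "exp_on K (\<lambda>_. 1) + top_exp (\<Union>\<C> - F) \<in> std_exps"
proof (rule std_expsI)
  note gv = generator_vertices[OF assms]
  show "Poly_Mapping.keys (exp_on K (\<lambda>_. 1) + top_exp (\<Union>\<C> - F)) \<in> \<Delta>"
    using assms(1)[unfolded admissible_def, THEN conjunct2, THEN conjunct2, THEN conjunct2, THEN conjunct1]
      assms(2) unfolding gv(5) by blast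
  have U: "\<Union>\<C> - F \<subseteq> {1..m}"
    using gv(2) by blast
  show "Poly_Mapping.lookup (exp_on K (\<lambda>_. 1) + top_exp (\<Union>\<C> - F)) i \<le> n i - 1" for i
  proof (cases "i \<in> K")
    case True
    then have "i \<in> {1..m}"
      using gv(2,3) assms(2) by blast
    then show ?thesis
      using True gv(3) n_ge_2[of i] by (auto simp: lookup_add lookup_exp_on[OF gv(1)] lookup_top_exp[OF U])
  qed (auto simp: lookup_add lookup_exp_on[OF gv(1)] lookup_top_exp[OF U])
qed

text \<open>As \<open>F \<subseteq> \<Union>\<C>\<close>, the generator has exponent
  \<open>d - top_exp F\<close>, so it is the image of the dual socle vector of \<open>F\<close>
  under the homomorphism of the balanced matrix \<open>N\<close>.\<close>

lemma generator_in_trace: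
  assumes adm: "admissible \<Delta> \<C> K" and F: "F \<in> \<C>"
  shows "mon (exp_on K (\<lambda>_. 1) + top_exp (\<Union>\<C> - F)) \<in> trace_ideal alg (omega :: ('k::field mpoly set, _) module)"
proof -
  note gv = generator_vertices[OF adm F]
  have std: "top_exp F \<in> std_exps"
    using top_exp_std[OF facet_face[OF gv(4)]] .
  have Fv: "F \<subseteq> {1..m}" "\<Union>\<C> - F \<subseteq> {1..m}"
    using gv(2) F by blast+
  define d where "d = exp_on K (\<lambda>_. 1) + top_exp (\<Union>\<C>)"
  define N :: "(nat \<Rightarrow>\<^sub>0 nat) \<Rightarrow> (nat \<Rightarrow>\<^sub>0 nat) \<Rightarrow> 'k" where
    "N = (\<lambda>b a. if (\<exists>F \<in> \<C>. Poly_Mapping.keys b \<subseteq> F) \<and> a + b = d then 1 else 0)"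
  have N: "balanced N"
    unfolding N_def d_def by (rule admissible_balanced[OF adm])
  have "top_exp (\<Union>\<C>) = top_exp (\<Union>\<C> - F) + top_exp F"
    using F by (intro poly_mapping_eqI)
      (auto simp: lookup_add lookup_top_exp[OF gv(2)] lookup_top_exp[OF Fv(1)] lookup_top_exp[OF Fv(2)])
  then have d: "d = exp_on K (\<lambda>_. 1) + top_exp (\<Union>\<C> - F) + top_exp F"
    by (simp add: d_def add.assoc)
  have "matrix_hom N (dual (top_exp F)) = mon (exp_on K (\<lambda>_. 1) + top_exp (\<Union>\<C> - F))"
  proof (rule alg_eqI)
    fix a assume a: "a \<in> std_exps"
    have "cf a (matrix_hom N (dual (top_exp F))) = N (top_exp F) a"
      by (simp add: cf_matrix_hom a dual_mon std finite_std_exps if_distrib[of "\<lambda>x. _ * x"] cong: if_cong sum.cong)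
    also have "\<dots> = (if a = exp_on K (\<lambda>_. 1) + top_exp (\<Union>\<C> - F) then 1 else 0)"
      using F by (auto simp: N_def keys_top_exp[OF Fv(1)] d)
    finally show "cf a (matrix_hom N (dual (top_exp F))) = cf a (mon (exp_on K (\<lambda>_. 1) + top_exp (\<Union>\<C> - F)))"
      by (simp add: cf_res[OF single_std_closed[OF generator_std[OF adm F]] a] lookup_single when_def del: One_nat_def)
  qed (rule matrix_hom_closed, rule std_mon_closed[OF generator_std[OF adm F]])
  then show ?thesis
    using trace_idealI[OF matrix_hom_hom[OF N] dual_closed[OF std]] by simp
qed

lemma J_ideal_eq:
  "J_ideal m \<Delta> n \<C> K = genideal alg
    {mon (exp_on K (\<lambda>_. 1) + top_exp (\<Union>\<C> - F)) :: 'k::field mpoly set | F. F \<in> \<C>}"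
  by (simp only: J_ideal_def generator_eq)

lemma J_gens_closed:
  "admissible \<Delta> \<C> K \<Longrightarrow>
    {mon (exp_on K (\<lambda>_. 1) + top_exp (\<Union>\<C> - F)) :: 'k::field mpoly set | F. F \<in> \<C>} \<subseteq> carrier alg"
  using generator_std std_exps_vertices mon_closed by blast

abbreviation J_sum :: "'k::field mpoly set set" where
  "J_sum \<equiv> ideal_sum alg {(\<C>, K). admissible \<Delta> \<C> K} (\<lambda>(\<C>, K). J_ideal m \<Delta> n \<C> K)"

lemma J_sum_ideal: "ideal (J_sum :: 'k::field mpoly set set) alg"
  and J_sumI: "admissible \<Delta> \<C> K \<Longrightarrow> F \<in> \<C> \<Longrightarrow>
    mon (exp_on K (\<lambda>_. 1) + top_exp (\<Union>\<C> - F)) \<in> (J_sum :: 'k mpoly set set)"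
proof -
  interpret A: cring "alg :: 'k mpoly set ring" by (rule face_algebra_cring)
  let ?S = "\<Union>(\<C>, K)\<in>{(\<C>, K). admissible \<Delta> \<C> K}. J_ideal m \<Delta> n \<C> K :: 'k mpoly set set"
  have J: "ideal (J_ideal m \<Delta> n \<C> K :: 'k mpoly set set) alg" if "admissible \<Delta> \<C> K" for \<C> K
    unfolding J_ideal_eq using that by (intro A.genideal_ideal J_gens_closed)
  have sub: "?S \<subseteq> carrier alg"
    using ideal.Icarr[OF J] by auto
  show "ideal (J_sum :: 'k::field mpoly set set) alg"
    unfolding ideal_sum_def by (rule A.genideal_ideal[OF sub])
  assume adm: "admissible \<Delta> \<C> K" "F \<in> \<C>"
  have "mon (exp_on K (\<lambda>_. 1) + top_exp (\<Union>\<C> - F)) \<in> (J_ideal m \<Delta> n \<C> K :: 'k mpoly set set)"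
    unfolding J_ideal_eq using A.genideal_self[OF J_gens_closed[OF adm(1)]] adm(2) by blast
  then have "mon (exp_on K (\<lambda>_. 1) + top_exp (\<Union>\<C> - F)) \<in> ?S"
    using adm(1) by blast
  then show "mon (exp_on K (\<lambda>_. 1) + top_exp (\<Union>\<C> - F)) \<in> (J_sum :: 'k mpoly set set)"
    unfolding ideal_sum_def using A.genideal_self[OF sub] by blast
qed

text \<open>It suffices to treat the monomials \<open>x^a\<close> occurring in the image of a dual
  vector. Lifting to a socle row yields a divisor \<open>a'\<close> of \<open>a\<close>, and
  \<open>balanced_admissible\<close> yields a generator dividing \<open>x^a'\<close>.\<close>

lemma trace_subset_J_sum:
  "trace_ideal alg (omega :: ('k::field mpoly set, _) module) \<subseteq> J_sum"
proof -
  interpret A: cring "alg :: 'k mpoly set ring" by (rule face_algebra_cring)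
  interpret J: ideal "J_sum :: 'k mpoly set set" alg by (rule J_sum_ideal)
  have "\<phi> l \<in> J_sum" if \<phi>: "\<phi> \<in> hom_to_ring alg omega" and l: "l \<in> carrier omega"
    for \<phi> and l :: "'k mpoly set \<Rightarrow> 'k"
  proof (rule hom_image_in_ideal[OF \<phi> J_sum_ideal _ l])
    fix b assume b: "b \<in> std_exps"
    have "\<phi> (dual b) \<in> carrier alg"
      using \<phi> dual_closed[OF b] by (auto simp: hom_to_ring_def)
    then show "\<phi> (dual b) \<in> J_sum"
    proof (rule mem_ideal_if_monomials[OF J_sum_ideal])
      fix a assume a: "a \<in> std_exps" and nz: "cf a (\<phi> (dual b)) \<noteq> 0"
      obtain F where F: "F \<in> facets \<Delta>" "Poly_Mapping.keys b \<subseteq> F"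
        using face_in_facet[OF std_exps_face[OF b]] by blast
      obtain a' where a': "a' \<preceq> a" "cf a' (\<phi> (dual (top_exp F))) \<noteq> 0"
        using balanced_lift[OF hom_balanced[OF \<phi>] facet_face[OF F(1)] b a F(2) nz] by blast
      obtain \<C> K where CK: "admissible \<Delta> \<C> K" "F \<in> \<C>"
          "exp_on K (\<lambda>_. 1) + top_exp (\<Union>\<C> - F) \<preceq> a'"
        using balanced_admissible[OF hom_balanced[OF \<phi>] F(1) std_exps_le[OF a a'(1)] a'(2)] by blast
      let ?g = "exp_on K (\<lambda>_. 1) + top_exp (\<Union>\<C> - F)"
      have g: "?g \<preceq> a"
        using CK(3) a'(1) unfolding exp_le_def by (meson le_trans)
      have std: "a - ?g \<in> std_exps"
        using std_exps_le[OF a exp_le_diff] .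
      have "mon (a - ?g) \<otimes>\<^bsub>alg\<^esub> mon ?g = (mon a :: 'k mpoly set)"
        using res_mult[OF single_std_closed[OF std] single_std_closed[OF generator_std[OF CK(1,2)]],
            of "1 :: 'k" "1 :: 'k"]
        by (simp only: mult_single exp_diff_add[OF g] mult_1_left)
      then show "(mon a :: 'k mpoly set) \<in> J_sum"
        using J.I_l_closed[OF J_sumI[OF CK(1,2)] std_mon_closed[OF std]] by metis
    qed
  qed
  then show ?thesis
    unfolding trace_ideal_def ideal_sum_def[of _ "hom_to_ring _ _"]
    by (intro A.genideal_minimal[OF J_sum_ideal]) auto
qed

lemma J_sum_subset_trace:
  "J_sum \<subseteq> trace_ideal alg (omega :: ('k::field mpoly set, _) module)"
proof -
  interpret A: cring "alg :: 'k mpoly set ring" by (rule face_algebra_cring)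
  have "(J_ideal m \<Delta> n \<C> K :: 'k mpoly set set) \<subseteq> trace_ideal alg omega" if "admissible \<Delta> \<C> K" for \<C> K
    unfolding J_ideal_eq using generator_in_trace[OF that]
    by (intro A.genideal_minimal[OF trace_ideal_ideal]) auto
  then show ?thesis
    unfolding ideal_sum_def by (intro A.genideal_minimal[OF trace_ideal_ideal]) auto
qed

end

theorem theoremA:
  fixes m :: nat and \<Delta> :: "nat set set" and n :: "nat \<Rightarrow> nat"
    and A :: "('k::field) mpoly set ring"
  assumes "simplicial_complex m \<Delta>"
    and "\<And>i. \<not> ghost_vertex m \<Delta> i"
    and "\<And>i. i \<in> {1..m} \<Longrightarrow> n i \<ge> 2"
    and "A = face_algebra m \<Delta> n"
  shows "trace_ideal A (face_algebra_canonical_module m \<Delta> n) =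
         ideal_sum A {(\<C>, K). admissible \<Delta> \<C> K} (\<lambda>(\<C>, K). J_ideal m \<Delta> n \<C> K)"
proof -
  interpret truncated_complex m \<Delta> n
    using assms(1,3) by unfold_locales
  show ?thesis
    unfolding assms(4) using trace_subset_J_sum J_sum_subset_trace by (rule equalityI)
qed

end
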